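(* Let $r=(r_n)_{n\in\mathbb N}$ be a sequence of positive reals decreasing to $0$. Define $$\bar{\mathbf i}:\mathcal B(\mathbb T)\to\mathcal G_{H,r}(\mathbb T),\ H\mapsto[(H*\psi_n)_n],\qquad \bar{\mathbf i}_0:\mathcal A_1(\mathbb T)\to\mathcal G_{H,r}(\mathbb T),\ f\mapsto[(f)_n],$$ where $(f)_n$ is the constant sequence with all terms equal to $f$. Then $\bar{\mathbf i}$ is a linear embedding (a well-defined injective linear map), $\bar{\mathbf i}_0$ is an injective morphism of algebras, and $\bar{\mathbf i}|_{\mathcal A_1(\mathbb T)}=\bar{\mathbf i}_0$.
   Context: $\mathbb T=\{z\in\mathbb C:|z|=1\}$. For $\lambda>1$, $\Omega_\lambda=\{z\in\mathbb C:1/\lambda<|z|<\lambda\}$, and $\mathcal O_\lambda$ is the Banach space of bounded holomorphic functions on $\Omega_\lambda$. $\mathcal A(\mathbb T)=\varinjlim_{\lambda\to1}\mathcal O_\lambda$ is the space of analytic functions on $\mathbb T$; $\hat f(k)$ denotes the coefficient of $z^k$ in the Laurent expansion of $f$. $\mathcal B(\mathbb T)$ is the space of hyperfunctions on $\mathbb T$ (the dual of $\mathcal A(\mathbb T)$); a hyperfunction $H$ is identified with its Fourier coefficients $(\hat H(k))_{k\in\mathbb Z}$, and a complex family $(c_k)_{k\in\mathbb Z}$ is the family of Fourier coefficients of some hyperfunction iff $\limsup_{|k|\to\infty}|c_k|^{1/|k|}\le1$; it comes from an analytic function iff this $\limsup$ is $<1$, which gives $\mathcal A(\mathbb T)\subset\mathcal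 B(\mathbb T)$. For $m\in[0,1)$ and $\nu>0$, $\mathcal A_{m,\nu}(\mathbb T)$ is the set of $f\in\mathcal A(\mathbb T)$ with $\sup_{t\in\mathbb R,\alpha\in\mathbb N}\frac{|\tilde f^{(\alpha)}(t)|}{\nu^\alpha\alpha!^m}<\infty$, where $\tilde f(t)=f(e^{it})$. Put $\mathcal A_m(\mathbb T)=\bigcup_{\nu>0}\mathcal A_{m,\nu}(\mathbb T)$ and $\mathcal A_1(\mathbb T)=\bigcup_{0\le m<1}\mathcal A_m(\mathbb T)$; $\mathcal A_1(\mathbb T)$ is a subalgebra of $\mathcal A(\mathbb T)$ (pointwise multiplication) whose elements extend holomorphically to $\mathbb C^*=\mathbb C\setminus\{0\}$. For $n\in\mathbb N$, $\psi_n(z)=\sum_{|k|\le1/r_n}z^k$, and $H*\psi_n$ is the function $z\mapsto\sum_{|k|\le1/r_n}\hat H(k)z^k$. For $\lambda>1$ and $f$ holomorphic and bounded on $\Omega_\lambda$, $q^\lambda(f)=\sup_{\Omega_\lambda}|f|$. Let $$\mathcal X_r(\mathbb T)=\Big\{(f_n)_n\in\mathcal A_1(\mathbb T)^{\mathbb N}:\exists\lambda>1,\ \limsup_{n\to\infty}q^\lambda(f_n)^{r_n}<\infty\Big\},$$ $$\mathcal N_r(\mathbb T)=\Big\{(f_n)_n\in\mathcal A_1(\mathbb T)^{\mathbb N}:\exists\lambda>1,\ \limsup_{n\to\infty}q^\lambda(f_n)^{r_n}=0\Big\},$$ where elements of $\mathcal A_1(\mathbb T)$ are identified with their holomorphic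 extensions to $\mathbb C^*$. With termwise operations $\mathcal X_r(\mathbb T)$ is an algebra, $\mathcal N_r(\mathbb T)$ is an ideal of it, and $\mathcal G_{H,r}(\mathbb T)=\mathcal X_r(\mathbb T)/\mathcal N_r(\mathbb T)$ is the algebra of generalized hyperfunctions on $\mathbb T$; $[\cdot]$ denotes the class. *)

theory Defs
  imports "HOL-Complex_Analysis.Complex_Analysis" "HOL-Algebra.QuotRing" "HOL-Algebra.Module"
    "HOL-Algebra.Algebraic_Closure_Type"
begin

typedef circle = "sphere (0::complex) 1"
  morphisms point_of circle_of
  by (rule exI[of _ 1]) simp

definition annulus :: "real \<Rightarrow> complex set" where
  "annulus l = {z. 1 / l < norm z \<and> norm z < l}"

definition qnorm :: "real \<Rightarrow> (complex \<Rightarrow> complex) \<Rightarrow> real" where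
  "qnorm l F = (SUP z\<in>annulus l. norm (F z))"

text \<open>The values of members of \<open>bdd_holo l\<close> outside the annulus are irrelevant.\<close>

definition bdd_holo :: "real \<Rightarrow> (complex \<Rightarrow> complex) set" where
  "bdd_holo l = {F. F holomorphic_on annulus l \<and> bounded (F ` annulus l)}"

definition on_circle :: "(complex \<Rightarrow> complex) \<Rightarrow> circle \<Rightarrow> complex" where
  "on_circle F = (\<lambda>z. F (point_of z))"

text \<open>
  The direct limit of the spaces of bounded holomorphic functions on the annuli. By the identity
  theorem an element of the limit is determined by its restriction to the circle, so the limit is
  realised as a set of functions on the circle.
\<close>

definition analytic_circle :: "(circle \<Rightarrow> complex) set" where
  "analytic_circle = {f. \<exists>l>1. \<exists>F\<in>bdd_holo l. f = on_circle F}"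

definition laurent_coeff :: "(circle \<Rightarrow> complex) \<Rightarrow> int \<Rightarrow> complex" where
  "laurent_coeff f = (THE c. \<exists>l>1. \<exists>F\<in>bdd_holo l. f = on_circle F \<and>
     (\<forall>z\<in>annulus l. ((\<lambda>k. c k * z powi k) has_sum F z) UNIV))"

text \<open>
  The topological dual of the direct limit: a linear functional on a locally convex inductive
  limit is continuous iff its restriction to each of the Banach spaces is bounded.
  Functionals are extensional, i.e. \<open>undefined\<close> outside the analytic functions.
\<close>

definition hyperfun :: "((circle \<Rightarrow> complex) \<Rightarrow> complex) set" where
  "hyperfun = {H \<in> extensional analytic_circle.
     (\<forall>f\<in>analytic_circle. \<forall>g\<in>analytic_circle. H (\<lambda>z. f z + g z) = H f + H g) \<and>
     (\<forall>a. \<forall>f\<in>analytic_circle. H (\<lambda>z. a * f z) = a * H f) \<and>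
     (\<forall>l>1. \<exists>C. \<forall>F\<in>bdd_holo l. norm (H (on_circle F)) \<le> C * qnorm l F)}"

text \<open>
  The sign convention is the one for which the hyperfunction
  \<open>g \<mapsto> (1 / 2\<pi>) \<integral> f (exp (\<i> t)) g (exp (\<i> t)) dt\<close> attached to an analytic function \<open>f\<close>
  has the Laurent coefficients of \<open>f\<close> as Fourier coefficients.
\<close>

definition fourier_coeff :: "((circle \<Rightarrow> complex) \<Rightarrow> complex) \<Rightarrow> int \<Rightarrow> complex" where
  "fourier_coeff H k = H (on_circle (\<lambda>z. z powi (- k)))"

text \<open>The embedding of the analytic functions into the hyperfunctions.\<close>

definition hyperfun_of :: "(circle \<Rightarrow> complex) \<Rightarrow> (circle \<Rightarrow> complex) \<Rightarrow> complex" where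
  "hyperfun_of f = (THE H. H \<in> hyperfun \<and> fourier_coeff H = laurent_coeff f)"

definition lift_line :: "(circle \<Rightarrow> complex) \<Rightarrow> real \<Rightarrow> complex" where
  "lift_line f t = f (circle_of (exp (\<i> * of_real t)))"

definition vderiv :: "nat \<Rightarrow> (real \<Rightarrow> complex) \<Rightarrow> real \<Rightarrow> complex" where
  "vderiv j = (\<lambda>g t. vector_derivative g (at t)) ^^ j"

definition gevrey_circle :: "real \<Rightarrow> real \<Rightarrow> (circle \<Rightarrow> complex) set" where
  "gevrey_circle m \<nu> = {f \<in> analytic_circle.
     bdd_above (range (\<lambda>(t::real, j::nat).
       norm (vderiv j (lift_line f) t) / (\<nu> ^ j * fact j powr m)))}"

definition A1_circle :: "(circle \<Rightarrow> complex) set" where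
  "A1_circle = (\<Union>m\<in>{0..<1}. \<Union>\<nu>\<in>{0<..}. gevrey_circle m \<nu>)"

text \<open>
  The holomorphic extension to the punctured plane; it is unique there, and its value
  at \<open>0\<close> is never used.
\<close>

definition holo_ext :: "(circle \<Rightarrow> complex) \<Rightarrow> complex \<Rightarrow> complex" where
  "holo_ext f = (SOME F. F holomorphic_on (UNIV - {0}) \<and> f = on_circle F)"

definition Xset :: "(nat \<Rightarrow> real) \<Rightarrow> (nat \<Rightarrow> circle \<Rightarrow> complex) set" where
  "Xset r = {f. (\<forall>n. f n \<in> A1_circle) \<and>
     (\<exists>l>1. limsup (\<lambda>n. ereal (qnorm l (holo_ext (f n)) powr r n)) < \<infinity>)}"

definition Nset :: "(nat \<Rightarrow> real) \<Rightarrow> (nat \<Rightarrow> circle \<Rightarrow> complex) set" where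
  "Nset r = {f. (\<forall>n. f n \<in> A1_circle) \<and>
     (\<exists>l>1. limsup (\<lambda>n. ereal (qnorm l (holo_ext (f n)) powr r n)) = 0)}"

abbreviation complex_ring :: "complex ring" where
  "complex_ring \<equiv> ring_of_type_algebra"

definition A1_alg :: "(complex, circle \<Rightarrow> complex) module" where
  "A1_alg = \<lparr>carrier = A1_circle,
     mult = (\<lambda>f g z. f z * g z), one = (\<lambda>z. 1),
     zero = (\<lambda>z. 0), add = (\<lambda>f g z. f z + g z),
     smult = (\<lambda>a f z. a * f z)\<rparr>"

definition X_alg :: "(nat \<Rightarrow> real) \<Rightarrow> (complex, nat \<Rightarrow> circle \<Rightarrow> complex) module" where
  "X_alg r = \<lparr>carrier = Xset r,
     mult = (\<lambda>f g n z. f n z * g n z), one = (\<lambda>n z. 1),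
     zero = (\<lambda>n z. 0), add = (\<lambda>f g n z. f n z + g n z),
     smult = (\<lambda>a f n z. a * f n z)\<rparr>"

text \<open>
  The quotient ring of the library, made into an algebra: as in \<^const>\<open>rcoset_mult\<close>, the
  multiple of a coset is the union of the classes of the multiples of its members.
\<close>

definition G_alg :: "(nat \<Rightarrow> real) \<Rightarrow> (complex, (nat \<Rightarrow> circle \<Rightarrow> complex) set) module" where
  "G_alg r = ring.extend (X_alg r Quot Nset r)
     (module.fields (\<lambda>a U. \<Union>f\<in>U. Nset r +>\<^bsub>X_alg r\<^esub> (a \<odot>\<^bsub>X_alg r\<^esub> f)))"

definition cls :: "(nat \<Rightarrow> real) \<Rightarrow> (nat \<Rightarrow> circle \<Rightarrow> complex) \<Rightarrow> (nat \<Rightarrow> circle \<Rightarrow> complex) set" where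
  "cls r f = Nset r +>\<^bsub>X_alg r\<^esub> f"

text \<open>Only a vector space, so the multiplicative fields of the record are left unspecified.\<close>

definition hyperfun_space :: "(complex, (circle \<Rightarrow> complex) \<Rightarrow> complex) module" where
  "hyperfun_space = \<lparr>carrier = hyperfun,
     mult = undefined, one = undefined,
     zero = (\<lambda>f\<in>analytic_circle. 0),
     add = (\<lambda>H K. \<lambda>f\<in>analytic_circle. H f + K f),
     smult = (\<lambda>a H. \<lambda>f\<in>analytic_circle. a * H f)\<rparr>"

text \<open>The theory qualifiers avoid the equally named locales of modules over a type and of
  algebras of sets.\<close>

definition linear_map ::
  "('k, 'c) ring_scheme \<Rightarrow> ('k, 'a, 'd) module_scheme \<Rightarrow> ('k, 'b, 'e) module_scheme \<Rightarrow> ('a \<Rightarrow> 'b) \<Rightarrow> bool"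
where
  "linear_map K V W h \<longleftrightarrow> Module.module K V \<and> Module.module K W \<and>
     h \<in> carrier V \<rightarrow> carrier W \<and>
     (\<forall>x\<in>carrier V. \<forall>y\<in>carrier V. h (x \<oplus>\<^bsub>V\<^esub> y) = h x \<oplus>\<^bsub>W\<^esub> h y) \<and>
     (\<forall>a\<in>carrier K. \<forall>x\<in>carrier V. h (a \<odot>\<^bsub>V\<^esub> x) = a \<odot>\<^bsub>W\<^esub> h x)"

definition algebra_morphism ::
  "('k, 'c) ring_scheme \<Rightarrow> ('k, 'a, 'd) module_scheme \<Rightarrow> ('k, 'b, 'e) module_scheme \<Rightarrow> ('a \<Rightarrow> 'b) \<Rightarrow> bool"
where
  "algebra_morphism K A B h \<longleftrightarrow> Module.algebra K A \<and> Module.algebra K B \<and>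
     h \<in> ring_hom A B \<and> linear_map K A B h"

definition conv_psi :: "(nat \<Rightarrow> real) \<Rightarrow> ((circle \<Rightarrow> complex) \<Rightarrow> complex) \<Rightarrow> nat \<Rightarrow> circle \<Rightarrow> complex" where
  "conv_psi r H n = on_circle (\<lambda>z. \<Sum>k | \<bar>real_of_int k\<bar> \<le> 1 / r n. fourier_coeff H k * z powi k)"

definition ibar :: "(nat \<Rightarrow> real) \<Rightarrow> ((circle \<Rightarrow> complex) \<Rightarrow> complex) \<Rightarrow> (nat \<Rightarrow> circle \<Rightarrow> complex) set" where
  "ibar r H = cls r (conv_psi r H)"

definition ibar0 :: "(nat \<Rightarrow> real) \<Rightarrow> (circle \<Rightarrow> complex) \<Rightarrow> (nat \<Rightarrow> circle \<Rightarrow> complex) set" where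
  "ibar0 r f = cls r (\<lambda>n. f)"

end

theory Submission
  imports Defs
begin

text \<open>
  A hyperfunction is determined by its Fourier coefficients because Laurent series converge
  uniformly on smaller annuli, so Laurent polynomials are dense in each step of the direct limit.

  For \<open>f\<close> in \<open>A1_circle\<close>, integrating by parts \<open>j\<close> times bounds the Laurent coefficients by
  \<open>\<bar>c k\<bar> * \<bar>k\<bar> ^ j \<le> C * \<nu> ^ j * (fact j) powr m\<close>; dividing by \<open>fact j\<close> and summing over \<open>j\<close> gives,
  as \<open>m < 1\<close>, \<open>\<bar>c k\<bar> = O(exp (- s * \<bar>k\<bar>))\<close> for every \<open>s\<close>. This yields the extension to the punctured
  plane, and it makes the tail \<open>f - f * \<psi>\<^sub>n\<close> over \<open>\<bar>k\<bar> > 1 / r n\<close> of size \<open>e powr (1 / r n)\<close> for every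
  \<open>e > 0\<close>, i.e. null. Conversely the Fourier coefficients of a null sequence tend to \<open>0\<close>, while
  those of \<open>H * \<psi>\<^sub>n\<close> are eventually constant in \<open>n\<close>; hence injectivity.
\<close>

section \<open>Laurent expansion on an annulus\<close>

text \<open>The two maps fit together because the cut-off \<open>1 / r n\<close> is matched to the
  scale of measurement. With the root removed, moderate means bounded by
  \<open>B powr (1 / r n)\<close> for one \<open>B\<close>, null means the same with every
  \<open>e > 0\<close>. On the kept frequencies a geometric growth \<open>b ^ |k|\<close> is at most
  \<open>b powr (1 / r n)\<close>, so truncated hyperfunctions are moderate. On the dropped ones a
  decay faster than every geometric rate is called for; a general analytic function decays only at
  some fixed rate, whence the restriction to order less than one.

  The obstacle is that \<open>holo_ext\<close> is a choice among extensions and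
  \<open>laurent_coeff\<close> a description over all radii and extensions. Both are tied to the
  circle by the Fourier integral \<open>circle_coeff\<close>: it is defined from the values on the
  circle alone, is bounded by the supremum there, and returns the coefficients of every Laurent
  series that represents a continuous function on the circle. Uniqueness of extensions then follows
  by comparing coefficients.\<close>

lemma circlepath_integral_radius_indep:
  assumes "open S" "f holomorphic_on S" "0 < r1" "0 < r2"
    and S: "\<And>z. min r1 r2 \<le> norm z \<Longrightarrow> norm z \<le> max r1 r2 \<Longrightarrow> z \<in> S"
  shows "contour_integral (circlepath 0 r1) f = contour_integral (circlepath 0 r2) f"
proof (rule Cauchy_theorem_homotopic_loops[OF _ assms(1,2)])
  show "homotopic_loops S (circlepath 0 r1) (circlepath 0 r2)"
  proof (rule homotopic_loops_linear)
    fix t :: real assume "t \<in> {0..1}"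
    define e where "e = exp (2 * of_real pi * \<i> * of_real t)"
    have e: "norm e = 1"
      by (simp add: e_def)
    \<comment> \<open>Both end points are multiples of the same unit vector \<open>e\<close>. The
      segment therefore lies on a ray, its radii are convex combinations of \<open>r1\<close> and
      \<open>r2\<close>, and the homotopy stays in the closed annulus.\<close>
    show "closed_segment (circlepath 0 r1 t) (circlepath 0 r2 t) \<subseteq> S"
    proof
      fix z assume "z \<in> closed_segment (circlepath 0 r1 t) (circlepath 0 r2 t)"
      then obtain u where u: "0 \<le> u" "u \<le> 1"
        and z: "z = (1 - u) *\<^sub>R (r1 * e) + u *\<^sub>R (r2 * e)"
        by (auto simp: closed_segment_def circlepath e_def)
      have "z = of_real ((1 - u) * r1 + u * r2) * e"
        by (simp add: z algebra_simps scaleR_conv_of_real)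
      then have "norm z = \<bar>(1 - u) * r1 + u * r2\<bar>"
        by (simp add: norm_mult e del: of_real_add of_real_mult of_real_diff)
      moreover have "(1 - u) * r1 + u * r2 \<ge> (1 - u) * min r1 r2 + u * min r1 r2"
        using u by (intro add_mono mult_left_mono) auto
      moreover have "(1 - u) * r1 + u * r2 \<le> (1 - u) * max r1 r2 + u * max r1 r2"
        using u by (intro add_mono mult_left_mono) auto
      moreover have "min r1 r2 > 0"
        using assms by simp
      ultimately show "z \<in> S"
        by (intro S) (simp_all only: left_diff_distrib mult_1_left, linarith+)
    qed
  qed auto
qed auto

text \<open>For \<open>|w| = R > |z|\<close> the kernel \<open>1 / (w - z)\<close> is a geometric
  series in \<open>z / w\<close>. It converges uniformly in \<open>w\<close>, so it may be
  integrated term by term. These terms become the nonnegative powers.\<close>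

lemma Cauchy_kernel_sums_outside:
  assumes "continuous_on (sphere 0 R) F" and z: "norm z < R"
  shows "(\<lambda>k. z ^ k * contour_integral (circlepath 0 R) (\<lambda>w. F w / w ^ Suc k))
           sums contour_integral (circlepath 0 R) (\<lambda>w. F w / (w - z))"
proof -
  have R: "R > 0"
    using z norm_ge_zero[of z] by linarith
  obtain B where B: "\<And>w. norm w = R \<Longrightarrow> norm (F w) \<le> B" "B > 0"
    using compact_imp_bounded[OF compact_continuous_image[OF assms(1) compact_sphere]]
    by (force simp: bounded_pos)
  define f where "f = (\<lambda>k w. F w * z ^ k / w ^ Suc k)"
  have cont: "continuous_on (sphere 0 R) (f k)" for k
    unfolding f_def using assms(1) R by (auto intro!: continuous_intros)
  have int: "(f k) contour_integrable_on circlepath 0 R" for k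
    using cont R by (intro contour_integrable_continuous_circlepath) auto
  have "uniform_limit (sphere 0 R) (\<lambda>n w. \<Sum>k<n. f k w) (\<lambda>w. \<Sum>k. f k w) sequentially"
  proof (rule Weierstrass_m_test)
    show "norm (f k w) \<le> B / R * (norm z / R) ^ k" if "w \<in> sphere 0 R" for k w
    proof -
      have w: "norm w = R" using that by simp
      have "norm (f k w) = norm (F w) * norm z ^ k / R ^ Suc k"
        by (simp add: f_def norm_mult norm_divide norm_power w del: power_Suc)
      also have "\<dots> \<le> B * norm z ^ k / R ^ Suc k"
        using B(1)[OF w] R by (intro divide_right_mono mult_right_mono) auto
      finally show ?thesis
        by (simp add: power_divide)
    qed
    show "summable (\<lambda>k. B / R * (norm z / R) ^ k)"
      using z R by (intro summable_mult summable_geometric) (auto simp: divide_simps)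
  qed
  moreover have "(\<Sum>k. f k w) = F w / (w - z)" if "w \<in> sphere 0 R" for w
  proof -
    have w: "norm w = R" "w \<noteq> 0" "w \<noteq> z" using that z R by auto
    have "(\<lambda>k. F w / w * (z / w) ^ k) sums (F w / w * (1 / (1 - z / w)))"
      using w z R by (intro sums_mult geometric_sums) (auto simp: norm_divide)
    moreover have "F w / w * (1 / (1 - z / w)) = F w / (w - z)"
      using w by (simp add: field_simps)
    ultimately show ?thesis
      using w by (simp add: sums_iff f_def power_divide)
  qed
  ultimately have "uniform_limit (sphere 0 R) (\<lambda>n w. \<Sum>k<n. f k w) (\<lambda>w. F w / (w - z)) sequentially"
    by (smt (verit) uniform_limit_cong' )
  then have "(\<lambda>n. contour_integral (circlepath 0 R) (\<lambda>w. \<Sum>k<n. f k w))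
      \<longlonglongrightarrow> contour_integral (circlepath 0 R) (\<lambda>w. F w / (w - z))"
    using R int
    by (intro contour_integral_uniform_limit_circlepath(2)) (auto intro!: always_eventually contour_integrable_sum)
  moreover have "contour_integral (circlepath 0 R) (\<lambda>w. \<Sum>k<n. f k w)
      = (\<Sum>k<n. z ^ k * contour_integral (circlepath 0 R) (\<lambda>w. F w / w ^ Suc k))" for n
  proof -
    have "(\<lambda>w. F w / w ^ Suc k) contour_integrable_on circlepath 0 R" for k
      using assms(1) R
      by (intro contour_integrable_continuous_circlepath) (auto intro!: continuous_intros)
    moreover have "f k = (\<lambda>w. z ^ k * (F w / w ^ Suc k))" for k
      by (auto simp: f_def)
    ultimately show ?thesis
      using int
      by (simp add: contour_integral_sum contour_integral_lmul del: power_Suc times_divide_eq_right)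
  qed
  ultimately show ?thesis
    by (simp add: sums_def)
qed

text \<open>Now the geometric series runs in \<open>w / z\<close>, and
  \<open>1 / (w - z) = - (1 / z) * (1 / (1 - w / z))\<close> brings in the minus sign. These terms
  become the negative powers.\<close>

lemma Cauchy_kernel_sums_inside:
  assumes "continuous_on (sphere 0 R) F" and "0 < R" and z: "R < norm z"
  shows "(\<lambda>k. inverse z ^ Suc k * contour_integral (circlepath 0 R) (\<lambda>w. F w * w ^ k))
           sums (- contour_integral (circlepath 0 R) (\<lambda>w. F w / (w - z)))"
proof -
  note R = assms(2)
  obtain B where B: "\<And>w. norm w = R \<Longrightarrow> norm (F w) \<le> B" "B > 0"
    using compact_imp_bounded[OF compact_continuous_image[OF assms(1) compact_sphere]]
    by (force simp: bounded_pos)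
  define f where "f = (\<lambda>k w. F w * w ^ k * inverse z ^ Suc k)"
  have cont: "continuous_on (sphere 0 R) (f k)" for k
    unfolding f_def using assms(1) R by (auto intro!: continuous_intros)
  have int: "(f k) contour_integrable_on circlepath 0 R" for k
    using cont R by (intro contour_integrable_continuous_circlepath) auto
  have "uniform_limit (sphere 0 R) (\<lambda>n w. \<Sum>k<n. f k w) (\<lambda>w. \<Sum>k. f k w) sequentially"
  proof (rule Weierstrass_m_test)
    show "norm (f k w) \<le> B / norm z * (R / norm z) ^ k" if "w \<in> sphere 0 R" for k w
    proof -
      have w: "norm w = R" using that by simp
      have "norm (f k w) = norm (F w) * R ^ k * inverse (norm z) ^ Suc k"
        by (simp add: f_def norm_mult norm_inverse norm_power w del: power_Suc)
      also have "\<dots> \<le> B * R ^ k * inverse (norm z) ^ Suc k"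
        using B(1)[OF w] R by (intro mult_right_mono) auto
      finally show ?thesis
        by (simp add: power_divide field_simps)
    qed
    show "summable (\<lambda>k. B / norm z * (R / norm z) ^ k)"
      using z R by (intro summable_mult summable_geometric) (auto simp: divide_simps)
  qed
  moreover have "(\<Sum>k. f k w) = - (F w / (w - z))" if "w \<in> sphere 0 R" for w
  proof -
    have w: "norm w = R" "z \<noteq> 0" "w \<noteq> z" using that z R by auto
    have "(\<lambda>k. F w / z * (w / z) ^ k) sums (F w / z * (1 / (1 - w / z)))"
      using w z R by (intro sums_mult geometric_sums) (auto simp: norm_divide)
    moreover have "F w / z * (1 / (1 - w / z)) = - (F w / (w - z))"
      using w by (simp add: field_simps)
    moreover have "F w / z * (w / z) ^ k = f k w" for k
      by (simp add: f_def field_simps)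
    ultimately show ?thesis
      using w by (simp add: sums_iff)
  qed
  ultimately have "uniform_limit (sphere 0 R) (\<lambda>n w. \<Sum>k<n. f k w) (\<lambda>w. - (F w / (w - z))) sequentially"
    by (smt (verit) uniform_limit_cong' )
  then have "(\<lambda>n. contour_integral (circlepath 0 R) (\<lambda>w. \<Sum>k<n. f k w))
      \<longlonglongrightarrow> contour_integral (circlepath 0 R) (\<lambda>w. - (F w / (w - z)))"
    using R int
    by (intro contour_integral_uniform_limit_circlepath(2)) (auto intro!: always_eventually contour_integrable_sum)
  moreover have "contour_integral (circlepath 0 R) (\<lambda>w. \<Sum>k<n. f k w)
      = (\<Sum>k<n. inverse z ^ Suc k * contour_integral (circlepath 0 R) (\<lambda>w. F w * w ^ k))" for n
  proof -
    have "(\<lambda>w. F w * w ^ k) contour_integrable_on circlepath 0 R" for k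
      using assms(1) R
      by (intro contour_integrable_continuous_circlepath) (auto intro!: continuous_intros)
    moreover have "f k = (\<lambda>w. inverse z ^ Suc k * (F w * w ^ k))" for k
      by (auto simp: f_def)
    ultimately show ?thesis
      using int
      by (simp add: contour_integral_sum contour_integral_lmul del: power_Suc times_divide_eq_right)
  qed
  moreover have "contour_integral (circlepath 0 R) (\<lambda>w. - (F w / (w - z)))
      = - contour_integral (circlepath 0 R) (\<lambda>w. F w / (w - z))"
    by (intro contour_integral_neg)
  ultimately show ?thesis
    by (simp add: sums_def)
qed

text \<open>The negative half is enumerated from -1, hence \<open>Suc n\<close>, so that the index 0
  belongs to the first series only.\<close>

lemma has_sum_int_from_nat:
  fixes f :: "int \<Rightarrow> 'a::{topological_comm_monoid_add,t2_space}"
  assumes "((\<lambda>n. f (int n)) has_sum a) UNIV" "((\<lambda>n. f (- int (Suc n))) has_sum b) UNIV"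
  shows "(f has_sum (a + b)) UNIV"
proof -
  have "(f has_sum a) {0..}"
    using assms(1) by (subst (asm) has_sum_reindex_bij_betw[where B = "{0..}"])
      (auto intro!: bij_betw_byWitness[where f' = nat] intro: rev_image_eqI[of "nat _"])
  moreover have "(f has_sum b) {..<0}"
    using assms(2) by (subst (asm) has_sum_reindex_bij_betw[where B = "{..<0}"])
      (auto intro!: bij_betw_byWitness[where f' = "\<lambda>k. nat (- k - 1)"])
  moreover have "{0..} \<union> {..<0} = (UNIV :: int set)" "{0..} \<inter> {..<0} = ({} :: int set)" by auto
  ultimately show ?thesis
    using has_sum_Un_disjoint[of f "{0..}" a "{..<0}" b] by simp
qed

text \<open>The difference quotient \<open>g\<close> has a removable singularity at
  \<open>z\<close>, so its integrals over the two circles agree. Splitting them leaves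
  \<open>F z\<close> times the integrals of \<open>1 / (w - z)\<close>, and \<open>z\<close> is
  enclosed by the outer circle only.\<close>

lemma annulus_Cauchy_formula:
  assumes S: "open S" and F: "F holomorphic_on S" and "0 < r1" "r1 < norm z" "norm z < r2"
    and sub: "\<And>z. r1 \<le> norm z \<Longrightarrow> norm z \<le> r2 \<Longrightarrow> z \<in> S"
  shows "contour_integral (circlepath 0 r2) (\<lambda>w. F w / (w - z))
       - contour_integral (circlepath 0 r1) (\<lambda>w. F w / (w - z)) = 2 * of_real pi * \<i> * F z"
proof -
  define g where "g = (\<lambda>w. if w = z then deriv F z else (F w - F z) / (w - z))"
  have "g holomorphic_on S"
    unfolding g_def by (rule pole_lemma_open[OF F S])
  then have eq: "contour_integral (circlepath 0 r1) g = contour_integral (circlepath 0 r2) g"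
    using assms by (intro circlepath_integral_radius_indep[of S]) auto
  have *: "contour_integral (circlepath 0 \<rho>) g
      = contour_integral (circlepath 0 \<rho>) (\<lambda>w. F w / (w - z))
        - F z * contour_integral (circlepath 0 \<rho>) (\<lambda>w. 1 / (w - z))"
    if "\<rho> = r1 \<or> \<rho> = r2" for \<rho>
  proof -
    have cont: "continuous_on (sphere 0 \<rho>) F"
      using that sub assms
      by (intro holomorphic_on_imp_continuous_on holomorphic_on_subset[OF F]) auto
    have ne: "\<forall>w\<in>sphere 0 \<rho>. w - z \<noteq> 0"
      using that assms by auto
    have "contour_integral (circlepath 0 \<rho>) g
      = contour_integral (circlepath 0 \<rho>) (\<lambda>w. F w / (w - z) - F z * (1 / (w - z)))"
      using ne assms that by (intro contour_integral_eq) (auto simp: g_def diff_divide_distrib)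
    also have "\<dots> = contour_integral (circlepath 0 \<rho>) (\<lambda>w. F w / (w - z))
        - contour_integral (circlepath 0 \<rho>) (\<lambda>w. F z * (1 / (w - z)))"
      using ne cont assms that
      by (intro contour_integral_diff contour_integrable_continuous_circlepath continuous_intros) auto
    also have "contour_integral (circlepath 0 \<rho>) (\<lambda>w. F z * (1 / (w - z)))
        = F z * contour_integral (circlepath 0 \<rho>) (\<lambda>w. 1 / (w - z))"
      using ne assms that
      by (intro contour_integral_lmul contour_integrable_continuous_circlepath continuous_intros) auto
    finally show ?thesis .
  qed
  have 1: "contour_integral (circlepath 0 r2) (\<lambda>w. 1 / (w - z)) = 2 * of_real pi * \<i> * 1"
    using assms by (intro contour_integral_unique Cauchy_integral_circlepath_simple) auto
  \<comment> \<open>\<open>1 / (w - z)\<close> is holomorphic in the disc of radius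
    \<open>norm z\<close> about 0, which contains the inner circle.\<close>
  have 2: "contour_integral (circlepath 0 r1) (\<lambda>w. 1 / (w - z)) = 0"
    using assms
    by (intro contour_integral_unique Cauchy_theorem_disc_simple[of _ 0 "norm z"])
       (auto intro!: holomorphic_intros)
  show ?thesis
    using eq *[of r1] *[of r2] by (simp add: 1 2 algebra_simps)
qed

text \<open>The coefficient integrals do not depend on the radius, so one set of coefficients, taken
  at the middle radius \<open>r0\<close>, serves every \<open>z\<close>. At a given \<open>z\<close>
  the nonnegative powers come from a circle outside \<open>z\<close> and the negative ones from a
  circle inside.\<close>

theorem Laurent_expansion_annulus:
  assumes "0 < r1" "r1 < r2" and F: "F holomorphic_on {z. r1 < norm z \<and> norm z < r2}"
  obtains c where
    "\<And>z. r1 < norm z \<Longrightarrow> norm z < r2 \<Longrightarrow> ((\<lambda>k. c k * z powi k) has_sum F z) UNIV"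
proof
  define S where "S = {z::complex. r1 < norm z \<and> norm z < r2}"
  have S: "open S"
    unfolding S_def by (intro open_Collect_conj open_Collect_less continuous_intros)
  define r0 where "r0 = (r1 + r2) / 2"
  define I where "I = (\<lambda>\<rho> k. contour_integral (circlepath 0 \<rho>) (\<lambda>w. F w * w powi (- k - 1)))"
  define c where "c = (\<lambda>k. I r0 k / (2 * of_real pi * \<i>))"
  have r0: "r1 < r0" "r0 < r2" using assms by (auto simp: r0_def)
  have I: "I \<rho> k = 2 * of_real pi * \<i> * c k" if "r1 < \<rho>" "\<rho> < r2" for \<rho> k
  proof -
    have "(\<lambda>w. F w * w powi (- k - 1)) holomorphic_on S"
      using F assms(1) unfolding S_def by (intro holomorphic_intros) auto
    then have "I \<rho> k = I r0 k"
      using that r0 S assms(1) unfolding I_def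
      by (intro circlepath_integral_radius_indep[of S]) (auto simp: S_def)
    then show ?thesis by (simp add: c_def)
  qed
  have contF: "continuous_on (sphere 0 \<rho>) F" if "r1 < \<rho>" "\<rho> < r2" for \<rho>
    using that by (intro holomorphic_on_imp_continuous_on holomorphic_on_subset[OF F]) auto
  have outer: "(\<lambda>k. c (int k) * z ^ k) sums
      (contour_integral (circlepath 0 R) (\<lambda>w. F w / (w - z)) / (2 * of_real pi * \<i>))"
    if "norm z < R" "r1 < R" "R < r2" for z R
  proof -
    have "z ^ k * contour_integral (circlepath 0 R) (\<lambda>w. F w / w ^ Suc k) / (2 * of_real pi * \<i>)
        = c (int k) * z ^ k" for k
    proof -
      have "F w / w ^ Suc k = F w * w powi (- int k - 1)" for w
      proof -
        have "- int k - 1 = - int (Suc k)" by simp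
        then show ?thesis
          by (simp only: power_int_minus power_int_of_nat divide_inverse)
      qed
      then have "contour_integral (circlepath 0 R) (\<lambda>w. F w / w ^ Suc k) = I R (int k)"
        unfolding I_def by presburger
      then show ?thesis using I[of R "int k"] that by (simp add: field_simps del: power_Suc)
    qed
    then show ?thesis
      using sums_divide[OF Cauchy_kernel_sums_outside[OF contF that(1)], of "2 * of_real pi * \<i>"] that
      by simp
  qed
  have inner: "(\<lambda>k. c (- int (Suc k)) * inverse z ^ Suc k) sums
      (- contour_integral (circlepath 0 R) (\<lambda>w. F w / (w - z)) / (2 * of_real pi * \<i>))"
    if "R < norm z" "r1 < R" "R < r2" for z R
  proof -
    have "inverse z ^ Suc k * contour_integral (circlepath 0 R) (\<lambda>w. F w * w ^ k) / (2 * of_real pi * \<i>)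
        = c (- int (Suc k)) * inverse z ^ Suc k" for k
    proof -
      have "contour_integral (circlepath 0 R) (\<lambda>w. F w * w ^ k) = I R (- int (Suc k))"
        by (simp add: I_def)
      then show ?thesis using I[of R "- int (Suc k)"] that
        by (simp add: field_simps del: power_Suc of_nat_Suc)
    qed
    then show ?thesis
      using sums_divide[OF Cauchy_kernel_sums_inside[OF contF _ that(1)], of "2 * of_real pi * \<i>"]
        that assms(1) by (simp del: power_Suc of_nat_Suc)
  qed
  fix z :: complex assume z: "r1 < norm z" "norm z < r2"
  then have z0: "z \<noteq> 0" using assms(1) by auto
  obtain R where R: "norm z < R" "R < r2" using z dense by blast
  obtain Q where Q: "r1 < Q" "Q < norm z" using z dense by blast
  obtain R' where R': "R < R'" "R' < r2" using R dense by blast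
  obtain Q' where Q': "r1 < Q'" "Q' < Q" using Q dense by blast
  have Rpos: "R > 0" using R norm_ge_zero[of z] by linarith
  \<comment> \<open>\<open>sums\<close> yields only ordered convergence, whereas
    \<open>has_sum\<close> is unconditional. Convergence at the larger point \<open>R\<close>,
    obtained from the still larger circle \<open>R'\<close>, makes the power series absolutely
    convergent at \<open>z\<close>.\<close>
  have sum1: "summable (\<lambda>k. norm (c (int k) * z ^ k))"
    by (rule powser_insidea[where x = "of_real R"])
       (use outer[of "of_real R" R'] R R' Q z Rpos in \<open>auto simp: sums_iff\<close>)
  have 1: "((\<lambda>k. c (int k) * z powi int k) has_sum
      (contour_integral (circlepath 0 R) (\<lambda>w. F w / (w - z)) / (2 * of_real pi * \<i>))) UNIV"
    unfolding power_int_of_nat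
    by (rule norm_summable_imp_has_sum[OF sum1 outer]) (use R z in linarith)+
  have Qpos: "Q > 0" using Q assms by simp
  \<comment> \<open>The same argument for a power series in \<open>inverse z\<close>, with
    \<open>Q' < Q < norm z\<close>. The powers are first shifted down by one to obtain a genuine
    power series, and the missing factor is restored afterwards.\<close>
  have "summable (\<lambda>k. norm (c (- int (Suc k)) * inverse z ^ k))"
  proof (rule powser_insidea[where x = "inverse (of_real Q)"])
    have "summable (\<lambda>k. c (- int (Suc k)) * inverse (of_real Q) ^ Suc k)"
      using inner[of Q' "of_real Q"] Q Q' R z by (auto simp: sums_iff)
    from summable_mult2[OF this, of "of_real Q"]
    show "summable (\<lambda>k. c (- int (Suc k)) * inverse (of_real Q) ^ k)"
      using Qpos by (simp add: field_simps)
    show "norm (inverse z) < norm (inverse (complex_of_real Q))"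
      using less_imp_inverse_less[OF Q(2) Qpos] Qpos
      by (simp only: norm_inverse norm_of_real abs_of_pos)
  qed
  from summable_mult2[OF this, of "norm (inverse z)"]
  have sum2: "summable (\<lambda>k. norm (c (- int (Suc k)) * inverse z ^ Suc k))"
    by (simp only: norm_mult power_Suc2 mult.assoc)
  have "((\<lambda>k. c (- int (Suc k)) * inverse z ^ Suc k) has_sum
      (- contour_integral (circlepath 0 Q) (\<lambda>w. F w / (w - z)) / (2 * of_real pi * \<i>))) UNIV"
    by (rule norm_summable_imp_has_sum[OF sum2 inner]) (use Q z in linarith)+
  moreover have "z powi (- int (Suc k)) = inverse z ^ Suc k" for k
    by (simp only: power_int_minus power_int_of_nat power_inverse)
  ultimately have 2: "((\<lambda>k. c (- int (Suc k)) * z powi (- int (Suc k))) has_sum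
      (- contour_integral (circlepath 0 Q) (\<lambda>w. F w / (w - z)) / (2 * of_real pi * \<i>))) UNIV"
    by (simp only:)
  have quot: "a / p + - b / p = x" if "a - b = p * x" "p \<noteq> 0" for a b p x :: complex
    using that by (simp flip: diff_divide_distrib)
  have "contour_integral (circlepath 0 R) (\<lambda>w. F w / (w - z))
       - contour_integral (circlepath 0 Q) (\<lambda>w. F w / (w - z)) = 2 * of_real pi * \<i> * F z"
    by (rule annulus_Cauchy_formula[OF S]) (use F Q R Qpos in \<open>auto simp: S_def\<close>)
  then have "contour_integral (circlepath 0 R) (\<lambda>w. F w / (w - z)) / (2 * of_real pi * \<i>)
       + - contour_integral (circlepath 0 Q) (\<lambda>w. F w / (w - z)) / (2 * of_real pi * \<i>) = F z"
    by (rule quot) simp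
  then show "((\<lambda>k. c k * z powi k) has_sum F z) UNIV"
    using has_sum_int_from_nat[OF 1 2] by (simp only:)
qed

section \<open>Fourier coefficients on the circle and hyperfunctions\<close>

lemma norm_point_of [simp]: "norm (point_of z) = 1"
  using point_of[of z] by simp

lemma point_of_nonzero [simp]: "point_of z \<noteq> 0"
  using norm_point_of[of z] by force

lemma point_of_circle_of: "norm w = 1 \<Longrightarrow> point_of (circle_of w) = w"
  by (rule circle_of_inverse) simp

lemma lift_line_on_circle: "lift_line (on_circle F) t = F (exp (\<i> * of_real t))"
  by (simp add: lift_line_def on_circle_def point_of_circle_of)

lemma on_circle_eq_iff: "on_circle F = on_circle G \<longleftrightarrow> (\<forall>z. norm z = 1 \<longrightarrow> F z = G z)"
  unfolding on_circle_def fun_eq_iff by (metis norm_point_of point_of_circle_of)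

lemma open_annulus: "open (annulus l)"
  unfolding annulus_def by (intro open_Collect_conj open_Collect_less continuous_intros)

lemma unit_in_annulus: "1 < l \<Longrightarrow> norm z = 1 \<Longrightarrow> z \<in> annulus l"
  by (auto simp: annulus_def)

lemma annulus_mono: "0 < l \<Longrightarrow> l \<le> l' \<Longrightarrow> annulus l \<subseteq> annulus l'"
  unfolding annulus_def using frac_le[of 1 1 l l'] by auto

lemma annulus_nonzero: "0 < l \<Longrightarrow> z \<in> annulus l \<Longrightarrow> z \<noteq> 0"
  unfolding annulus_def by auto

text \<open>The annulus is invariant under inversion, so one weight \<open>\<rho> ^ |k|\<close>
  covers both signs of the exponent.\<close>

lemma norm_powi_le:
  fixes z :: complex
  assumes "1 \<le> \<rho>" "1 / \<rho> \<le> norm z" "norm z \<le> \<rho>"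
  shows "norm (z powi k) \<le> \<rho> ^ nat \<bar>k\<bar>"
proof (cases "k \<ge> 0")
  case True
  then show ?thesis
    using assms by (simp add: power_int_def norm_power power_mono)
next
  case False
  have "norm (inverse z) \<le> \<rho>"
    using assms by (metis divide_inverse inverse_inverse_eq le_imp_inverse_le mult_1 norm_inverse
      inverse_positive_iff_positive zero_less_one less_le_trans)
  then have "norm (inverse z) ^ nat (-k) \<le> \<rho> ^ nat (-k)"
    by (intro power_mono) auto
  then show ?thesis
    using False by (simp add: power_int_def norm_power norm_inverse)
qed

text \<open>The left side is the sum over the complement of \<open>A\<close>, estimated termwise.
  The right side does not mention \<open>z\<close>, so the bound gives uniform convergence on the
  annulus, and with \<open>\<rho> = 1\<close> on the circle.\<close>

lemma Laurent_tail_bound: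
  fixes z :: complex
  assumes "1 \<le> \<rho>" "1 / \<rho> \<le> norm z" "norm z \<le> \<rho>" "finite A"
    and S: "((\<lambda>k. c k * z powi k) has_sum S) UNIV"
    and M: "((\<lambda>k. norm (c k) * \<rho> ^ nat \<bar>k\<bar>) has_sum M) UNIV"
  shows "norm (S - (\<Sum>k\<in>A. c k * z powi k)) \<le> M - (\<Sum>k\<in>A. norm (c k) * \<rho> ^ nat \<bar>k\<bar>)"
proof -
  have "((\<lambda>k. c k * z powi k) has_sum (S - (\<Sum>k\<in>A. c k * z powi k))) (UNIV - A)"
    using assms(4) by (intro has_sum_Diff[OF S]) (auto intro: has_sum_finite)
  moreover have "((\<lambda>k. norm (c k) * \<rho> ^ nat \<bar>k\<bar>) has_sum
      (M - (\<Sum>k\<in>A. norm (c k) * \<rho> ^ nat \<bar>k\<bar>))) (UNIV - A)"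
    using assms(4) by (intro has_sum_Diff[OF M]) (auto intro: has_sum_finite)
  ultimately show ?thesis
    by (rule norm_infsum_le) (simp add: norm_mult mult_left_mono norm_powi_le assms(1-3))
qed

lemma has_sum_finite_subset_approx:
  assumes "(f has_sum M) UNIV" "0 < e"
  obtains Y where "finite Y" "\<And>A. finite A \<Longrightarrow> Y \<subseteq> A \<Longrightarrow> dist (\<Sum>k\<in>A. f k) M < e"
proof -
  have "eventually (\<lambda>A. dist (\<Sum>k\<in>A. f k) M < e) (finite_subsets_at_top UNIV)"
    using assms tendstoD unfolding has_sum_def by blast
  then show ?thesis
    using that unfolding eventually_finite_subsets_at_top by auto
qed

section \<open>Fourier integrals on the circle\<close>

definition circle_mean :: "(circle \<Rightarrow> complex) \<Rightarrow> complex" where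
  "circle_mean f = integral {0..2 * pi} (lift_line f) / (2 * pi)"

text \<open>Unlike \<open>laurent_coeff\<close>, this refers to no extension: it depends on the
  values on the circle alone, and on continuous functions it is linear and bounded by the
  supremum.\<close>

definition circle_coeff :: "(circle \<Rightarrow> complex) \<Rightarrow> int \<Rightarrow> complex" where
  "circle_coeff f k = circle_mean (\<lambda>z. f z * point_of z powi (- k))"

lemma lift_line_circle_coeff_integrand:
  "lift_line (\<lambda>z. f z * point_of z powi k) t = lift_line f t * exp (\<i> * of_int k * of_real t)"
proof -
  have "exp (\<i> * of_real t) powi k = exp (\<i> * of_int k * of_real t)"
    using exp_power_int[of "\<i> * of_real t" k] by (simp add: mult_ac)
  then show ?thesis
    by (simp add: lift_line_def point_of_circle_of)
qed

lemma norm_circle_mean_le: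
  assumes "continuous_on UNIV (lift_line f)" "\<And>z. norm (f z) \<le> B"
  shows "norm (circle_mean f) \<le> B"
proof -
  have "norm (integral {0..2 * pi} (lift_line f)) \<le> B * (2 * pi - 0)"
    using assms by (intro integral_bound) (auto intro: continuous_on_subset simp: lift_line_def)
  then show ?thesis
    by (simp add: circle_mean_def norm_divide field_simps)
qed

lemma circle_mean_add:
  assumes "continuous_on UNIV (lift_line f)" "continuous_on UNIV (lift_line g)"
  shows "circle_mean (\<lambda>z. f z + g z) = circle_mean f + circle_mean g"
proof -
  have "lift_line (\<lambda>z. f z + g z) = (\<lambda>t. lift_line f t + lift_line g t)"
    by (auto simp: lift_line_def)
  moreover have "lift_line f integrable_on {0..2 * pi}" "lift_line g integrable_on {0..2 * pi}"
    using assms by (auto intro!: integrable_continuous_real intro: continuous_on_subset)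
  ultimately show ?thesis
    by (simp add: circle_mean_def integral_add add_divide_distrib)
qed

lemma circle_mean_cmult: "circle_mean (\<lambda>z. a * f z) = a * circle_mean f"
proof -
  have "lift_line (\<lambda>z. a * f z) = (\<lambda>t. a * lift_line f t)"
    by (auto simp: lift_line_def)
  then show ?thesis
    by (simp add: circle_mean_def)
qed

lemma circle_mean_powi: "circle_mean (\<lambda>z. point_of z powi k) = (if k = 0 then 1 else 0)"
proof (cases "k = 0")
  case True
  have "lift_line (\<lambda>z. 1) = (\<lambda>t. 1)"
    by (auto simp: lift_line_def)
  then show ?thesis
    using True by (simp add: circle_mean_def scaleR_conv_of_real)
next
  case False
  define G where "G = (\<lambda>t. exp (\<i> * of_int k * of_real t) / (\<i> * of_int k))"
  have "((\<lambda>t. exp (\<i> * of_int k * of_real t)) has_integral (G (2 * pi) - G 0)) {0..2 * pi}"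
  proof (rule fundamental_theorem_of_calculus)
    fix t :: real
    have "((\<lambda>w. exp (\<i> * of_int k * w) / (\<i> * of_int k)) has_field_derivative
        exp (\<i> * of_int k * of_real t)) (at (of_real t))"
      using False by (auto intro!: derivative_eq_intros)
    from has_vector_derivative_real_field[OF this]
    show "(G has_vector_derivative exp (\<i> * of_int k * of_real t)) (at t within {0..2 * pi})"
      unfolding G_def .
  qed simp
  moreover have "exp (\<i> * of_int k * of_real (2 * pi)) = 1"
    using exp_integer_2pi[of "of_int k"] by (simp add: mult_ac)
  then have "G (2 * pi) - G 0 = 0"
    by (simp add: G_def)
  moreover have "lift_line (\<lambda>z. point_of z powi k) = (\<lambda>t. exp (\<i> * of_int k * of_real t))"
    using lift_line_circle_coeff_integrand[of "\<lambda>z. 1" k] by (auto simp: lift_line_def)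
  ultimately show ?thesis
    using False by (simp add: circle_mean_def integral_unique)
qed

lemma continuous_lift_line:
  assumes "continuous_on (sphere 0 1) F"
  shows "continuous_on UNIV (lift_line (on_circle F))"
  unfolding lift_line_on_circle
  by (rule continuous_on_compose2[OF assms]) (auto intro!: continuous_intros)

lemma holomorphic_annulus_continuous_sphere:
  assumes "F holomorphic_on annulus l" "1 < l"
  shows "continuous_on (sphere 0 1) F"
  using assms unit_in_annulus
  by (intro holomorphic_on_imp_continuous_on holomorphic_on_subset[OF assms(1)]) auto

lemma continuous_circle_coeff_integrand:
  assumes "continuous_on UNIV (lift_line f)"
  shows "continuous_on UNIV (lift_line (\<lambda>z. f z * point_of z powi k))"
  unfolding lift_line_circle_coeff_integrand by (intro continuous_intros assms)

lemma circle_coeff_polynomial: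
  assumes "finite A"
  shows "circle_coeff (\<lambda>z. \<Sum>j\<in>A. c j * point_of z powi j) k = (if k \<in> A then c k else 0)"
proof -
  have cont: "continuous_on UNIV (lift_line (\<lambda>z. \<Sum>j\<in>B. c j * point_of z powi (j - k)))" for B
    using continuous_circle_coeff_integrand[of "\<lambda>z. 1"]
    by (auto simp: lift_line_def intro!: continuous_on_sum continuous_on_mult_left)
  have "circle_mean (\<lambda>z. \<Sum>j\<in>A. c j * point_of z powi (j - k)) = (\<Sum>j\<in>A. if j = k then c j else 0)"
    using assms
  proof induction
    case empty
    then show ?case using circle_mean_cmult[of 0 "\<lambda>z. 0"] by simp
  next
    case (insert j A)
    have "circle_mean (\<lambda>z. \<Sum>j\<in>insert j A. c j * point_of z powi (j - k))
        = circle_mean (\<lambda>z. c j * point_of z powi (j - k))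
        + circle_mean (\<lambda>z. \<Sum>j\<in>A. c j * point_of z powi (j - k))"
      using circle_mean_add[OF cont[of "{j}"] cont[of A]] insert by simp
    then show ?case
      using insert by (auto simp: circle_mean_cmult circle_mean_powi)
  qed
  moreover have "(\<Sum>j\<in>A. c j * point_of z powi j) * point_of z powi (- k)
      = (\<Sum>j\<in>A. c j * point_of z powi (j - k))" for z
    by (simp add: sum_distrib_right power_int_diff power_int_minus divide_inverse mult.assoc)
  ultimately show ?thesis
    using assms by (simp add: circle_coeff_def sum.delta)
qed

lemma circle_coeff_add:
  assumes "continuous_on UNIV (lift_line f)" "continuous_on UNIV (lift_line g)"
  shows "circle_coeff (\<lambda>z. f z + g z) k = circle_coeff f k + circle_coeff g k"
  unfolding circle_coeff_def distrib_right
  by (intro circle_mean_add continuous_circle_coeff_integrand assms)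

lemma norm_circle_coeff_le:
  assumes "continuous_on UNIV (lift_line f)" "\<And>z. norm (f z) \<le> B"
  shows "norm (circle_coeff f k) \<le> B"
  unfolding circle_coeff_def
  by (intro norm_circle_mean_le continuous_circle_coeff_integrand assms)
     (simp add: assms norm_mult norm_power_int)

text \<open>Unconditional convergence at \<open>z = 1\<close> already makes the coefficients
  absolutely summable. Hence a finite partial sum is within \<open>e\<close> of \<open>F\<close>
  uniformly on the circle. Its index set is made to contain \<open>k\<close>, so that by
  orthogonality its \<open>k\<close>-th Fourier integral is exactly \<open>c k\<close>.\<close>

theorem Laurent_coefficients_unique:
  assumes cont: "continuous_on (sphere 0 1) F"
    and sum: "\<And>z. norm z = 1 \<Longrightarrow> ((\<lambda>k. c k * z powi k) has_sum F z) UNIV"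
  shows "circle_coeff (on_circle F) k = c k"
proof -
  have "(\<lambda>k. norm (c k)) summable_on UNIV"
    using sum[of 1] by (auto simp: summable_on_iff_abs_summable_on_complex dest: has_sum_imp_summable)
  then obtain M where M: "((\<lambda>k. norm (c k)) has_sum M) UNIV"
    by (auto simp: summable_on_def)
  have "norm (circle_coeff (on_circle F) k - c k) \<le> e" if "e > 0" for e
  proof -
    from has_sum_finite_subset_approx[OF M that] obtain Y where Y: "finite Y"
      "\<And>A. finite A \<Longrightarrow> Y \<subseteq> A \<Longrightarrow> dist (\<Sum>k\<in>A. norm (c k)) M < e" by blast
    define A where "A = insert k Y"
    have A: "finite A" "k \<in> A" "dist (\<Sum>k\<in>A. norm (c k)) M < e"
      using Y(1) Y(2)[of A] by (simp_all add: A_def subset_insertI)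
    define P where "P = (\<lambda>z. \<Sum>j\<in>A. c j * z powi j)"
    have contP: "continuous_on (sphere 0 1) P"
      unfolding P_def by (auto intro!: continuous_intros)
    have M': "((\<lambda>k. norm (c k) * 1 ^ nat \<bar>k\<bar>) has_sum M) UNIV"
      using M by simp
    have "norm (F z - P z) \<le> e" if z: "norm z = 1" for z
    proof -
      have "norm (F z - P z) \<le> M - (\<Sum>k\<in>A. norm (c k) * 1 ^ nat \<bar>k\<bar>)"
        unfolding P_def by (rule Laurent_tail_bound[OF _ _ _ A(1) sum[OF z] M']) (simp_all add: z)
      then show ?thesis
        using A(3) by (simp add: dist_real_def)
    qed
    then have "norm (circle_coeff (on_circle (\<lambda>z. F z - P z)) k) \<le> e"
      by (intro norm_circle_coeff_le continuous_lift_line continuous_intros cont contP)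
         (simp add: on_circle_def)
    moreover have "circle_coeff (on_circle F) k
        = circle_coeff (on_circle (\<lambda>z. F z - P z)) k + circle_coeff (on_circle P) k"
      using circle_coeff_add[of "on_circle (\<lambda>z. F z - P z)" "on_circle P" k]
        continuous_lift_line[OF continuous_on_diff[OF cont contP]] continuous_lift_line[OF contP]
      by (simp add: on_circle_def)
    moreover have "circle_coeff (on_circle P) k = c k"
      using circle_coeff_polynomial[OF A(1), of c k] A(2) by (simp add: P_def on_circle_def)
    ultimately show ?thesis by simp
  qed
  then show ?thesis
    using field_le_epsilon[of "norm (circle_coeff (on_circle F) k - c k)" 0] by simp
qed

theorem circle_Laurent_expansion:
  assumes F: "F holomorphic_on annulus l" and "1 < l" and z: "z \<in> annulus l"
  shows "((\<lambda>k. circle_coeff (on_circle F) k * z powi k) has_sum F z) UNIV"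
proof -
  obtain c where c: "\<And>z. z \<in> annulus l \<Longrightarrow> ((\<lambda>k. c k * z powi k) has_sum F z) UNIV"
  proof (rule Laurent_expansion_annulus[of "1 / l" l F])
    show "F holomorphic_on {z. 1 / l < cmod z \<and> cmod z < l}"
      using F by (simp add: annulus_def)
    show "1 / l < l"
      using assms by (simp add: divide_less_eq less_1_mult)
  qed (use assms in \<open>auto simp: annulus_def\<close>)
  have "circle_coeff (on_circle F) k = c k" for k
    using assms
    by (intro Laurent_coefficients_unique c unit_in_annulus holomorphic_annulus_continuous_sphere)
  then show ?thesis using c[OF z] by simp
qed

text \<open>\<open>\<rho> ^ |k|\<close> is at most
  \<open>\<rho> powi k + (1 / \<rho>) powi k\<close>, and both \<open>\<rho>\<close> and
  \<open>1 / \<rho>\<close> are points of the annulus, where the Laurent series converges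
  absolutely.\<close>

lemma circle_coeff_abs_summable:
  assumes F: "F holomorphic_on annulus l" and "1 \<le> \<rho>" "\<rho> < l"
  shows "(\<lambda>k. norm (circle_coeff (on_circle F) k) * \<rho> ^ nat \<bar>k\<bar>) summable_on UNIV"
proof -
  let ?c = "circle_coeff (on_circle F)"
  have *: "(\<lambda>k. norm (?c k) * x powi k) summable_on UNIV" if "of_real x \<in> annulus l" "x > 0" for x
  proof -
    have "(\<lambda>k. norm (?c k * of_real x powi k)) summable_on UNIV"
      using circle_Laurent_expansion[OF F _ that(1)] assms has_sum_imp_summable
      by (subst summable_on_iff_abs_summable_on_complex [symmetric]) force
    then show ?thesis
      using that(2) by (simp add: norm_mult norm_power_int)
  qed
  have "1 / l < 1 / \<rho>" "1 / l < \<rho>" "1 / \<rho> < l"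
    using assms frac_less2[of 1 1 \<rho> l] mult_less_le_imp_less[of 1 l 1 \<rho>]
    by (auto simp: divide_less_eq mult.commute)
  then have 1: "of_real \<rho> \<in> annulus l" "of_real (1 / \<rho>) \<in> annulus l"
    using assms unfolding annulus_def by (auto simp: norm_divide)
  have "(\<lambda>k. norm (?c k) * \<rho> powi k + norm (?c k) * (1 / \<rho>) powi k) summable_on UNIV"
    using assms by (intro summable_on_add * 1) auto
  then show ?thesis
  proof (rule summable_on_comparison_test)
    fix k :: int
    have "\<rho> ^ nat \<bar>k\<bar> \<le> \<rho> powi k + (1 / \<rho>) powi k"
      using assms by (auto simp: power_int_def divide_inverse)
    from mult_left_mono[OF this, of "norm (?c k)"]
    show "norm (?c k) * \<rho> ^ nat \<bar>k\<bar> \<le> norm (?c k) * \<rho> powi k + norm (?c k) * (1 / \<rho>) powi k"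
      by (simp add: distrib_left)
  qed (use assms in auto)
qed

text \<open>The description ranges over all radii and extensions, but each candidate family consists
  of the Fourier integrals of the same boundary values, so there is only one.\<close>

lemma laurent_coeff_eq_circle_coeff:
  assumes "f \<in> analytic_circle"
  shows "laurent_coeff f = circle_coeff f"
  unfolding laurent_coeff_def
proof (rule the_equality)
  obtain l F where "l > 1" "F \<in> bdd_holo l" "f = on_circle F"
    using assms by (auto simp: analytic_circle_def)
  then show "\<exists>l>1. \<exists>F\<in>bdd_holo l. f = on_circle F \<and>
      (\<forall>z\<in>annulus l. ((\<lambda>k. circle_coeff f k * z powi k) has_sum F z) UNIV)"
    using circle_Laurent_expansion[of F l]
    by (intro exI[of _ l] conjI bexI[of _ F]) (auto simp: bdd_holo_def)
next
  fix c assume "\<exists>l>1. \<exists>F\<in>bdd_holo l. f = on_circle F \<and>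
      (\<forall>z\<in>annulus l. ((\<lambda>k. c k * z powi k) has_sum F z) UNIV)"
  then obtain l F where *: "l > 1" "F holomorphic_on annulus l" "f = on_circle F"
    "\<And>z. z \<in> annulus l \<Longrightarrow> ((\<lambda>k. c k * z powi k) has_sum F z) UNIV"
    by (auto simp: bdd_holo_def)
  then have "circle_coeff f k = c k" for k
    using Laurent_coefficients_unique[of F c k] holomorphic_annulus_continuous_sphere unit_in_annulus
    by blast
  then show "c = circle_coeff f" by auto
qed

section \<open>Bounded holomorphic functions on annuli\<close>

lemma bdd_holo_punctured_plane:
  assumes "F holomorphic_on UNIV - {0}"
  shows "F \<in> bdd_holo l"
proof (cases "l > 0")
  case l: True
  have "compact {z::complex. 1 / l \<le> norm z \<and> norm z \<le> l}"
    unfolding compact_eq_bounded_closed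
    by (auto intro!: closed_Collect_conj closed_Collect_le continuous_intros
        boundedI[of _ l])
  then have "bounded (F ` {z. 1 / l \<le> norm z \<and> norm z \<le> l})"
    using l by (intro compact_imp_bounded compact_continuous_image holomorphic_on_imp_continuous_on
        holomorphic_on_subset[OF assms]) auto
  then have "bounded (F ` annulus l)"
    by (rule bounded_subset) (auto simp: annulus_def)
  then show ?thesis
    using l annulus_nonzero by (auto simp: bdd_holo_def intro!: holomorphic_on_subset[OF assms])
next
  case False
  \<comment> \<open>No \<open>z\<close> satisfies \<open>norm z < l\<close> when
    \<open>l \<le> 0\<close>, so the claim holds for every real \<open>l\<close>.\<close>
  then have "annulus l = {}"
    unfolding annulus_def using norm_ge_zero by (auto, smt (verit) norm_ge_zero)
  then show ?thesis by (simp add: bdd_holo_def holomorphic_on_def)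
qed

lemma qnorm_upper:
  assumes "F \<in> bdd_holo l" "z \<in> annulus l"
  shows "norm (F z) \<le> qnorm l F"
  unfolding qnorm_def using assms
  by (intro cSUP_upper) (auto simp: bdd_holo_def bounded_iff bdd_above_def)

lemma qnorm_least:
  assumes "1 < l" "\<And>z. z \<in> annulus l \<Longrightarrow> norm (F z) \<le> B"
  shows "qnorm l F \<le> B"
  unfolding qnorm_def using assms unit_in_annulus[of l 1] by (intro cSUP_least) auto

lemma qnorm_nonneg:
  assumes "1 < l" "F \<in> bdd_holo l"
  shows "0 \<le> qnorm l F"
  using qnorm_upper[OF assms(2) unit_in_annulus[of l 1]] assms(1) norm_ge_zero[of "F 1"]
  by (auto intro: order_trans[OF norm_ge_zero])

lemma bdd_holo_mono:
  assumes "0 < l" "l \<le> l'" "F \<in> bdd_holo l'"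
  shows "F \<in> bdd_holo l"
  using annulus_mono[OF assms(1,2)] assms(3)
  by (auto simp: bdd_holo_def intro: holomorphic_on_subset bounded_subset)

lemma bdd_holo_add: "F \<in> bdd_holo l \<Longrightarrow> G \<in> bdd_holo l \<Longrightarrow> (\<lambda>z. F z + G z) \<in> bdd_holo l"
  by (auto simp: bdd_holo_def intro!: holomorphic_intros bounded_plus_comp)

lemma bdd_holo_cmult: "F \<in> bdd_holo l \<Longrightarrow> (\<lambda>z. a * F z) \<in> bdd_holo l"
  using bounded_linear_image[OF _ bounded_linear_mult_right[of a]]
  by (fastforce simp: bdd_holo_def image_image intro!: holomorphic_intros)

lemma bdd_holo_mult:
  assumes "F \<in> bdd_holo l" "G \<in> bdd_holo l"
  shows "(\<lambda>z. F z * G z) \<in> bdd_holo l"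
proof -
  obtain A B where "\<And>z. z \<in> annulus l \<Longrightarrow> norm (F z) \<le> A" "\<And>z. z \<in> annulus l \<Longrightarrow> norm (G z) \<le> B"
    using assms by (auto simp: bdd_holo_def bounded_iff)
  then have "norm (F z * G z) \<le> A * B" if "z \<in> annulus l" for z
    using that by (auto simp: norm_mult intro!: mult_mono intro: order_trans[OF norm_ge_zero])
  then have "bounded ((\<lambda>z. F z * G z) ` annulus l)"
    by (auto intro!: boundedI)
  then show ?thesis
    using assms by (auto simp: bdd_holo_def intro!: holomorphic_intros)
qed

lemma analytic_circle_pair:
  assumes "f \<in> analytic_circle" "g \<in> analytic_circle"
  obtains l F G where "1 < l" "F \<in> bdd_holo l" "G \<in> bdd_holo l" "f = on_circle F" "g = on_circle G"
proof -
  obtain l F l' G where *: "1 < l" "F \<in> bdd_holo l" "f = on_circle F"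
    "1 < l'" "G \<in> bdd_holo l'" "g = on_circle G"
    using assms by (auto simp: analytic_circle_def)
  have "F \<in> bdd_holo (min l l')" "G \<in> bdd_holo (min l l')"
    using * by (auto intro: bdd_holo_mono[of _ l] bdd_holo_mono[of _ l'])
  then show ?thesis
    using that[of "min l l'" F G] * by auto
qed

lemma analytic_circle_add:
  "f \<in> analytic_circle \<Longrightarrow> g \<in> analytic_circle \<Longrightarrow> (\<lambda>z. f z + g z) \<in> analytic_circle"
  by (erule (1) analytic_circle_pair)
     (auto simp: analytic_circle_def on_circle_def intro!: exI bexI[OF _ bdd_holo_add])

lemma analytic_circle_mult:
  "f \<in> analytic_circle \<Longrightarrow> g \<in> analytic_circle \<Longrightarrow> (\<lambda>z. f z * g z) \<in> analytic_circle"
  by (erule (1) analytic_circle_pair)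
     (auto simp: analytic_circle_def on_circle_def intro!: exI bexI[OF _ bdd_holo_mult])

lemma analytic_circle_punctured_plane:
  "F holomorphic_on UNIV - {0} \<Longrightarrow> on_circle F \<in> analytic_circle"
  using bdd_holo_punctured_plane[of F 2] unfolding analytic_circle_def
  by (auto intro!: exI[of _ "2::real"])

lemma analytic_circle_cmult: "f \<in> analytic_circle \<Longrightarrow> (\<lambda>z. a * f z) \<in> analytic_circle"
  using analytic_circle_mult[OF analytic_circle_punctured_plane[of "\<lambda>z. a"]]
  by (simp add: on_circle_def)

lemma analytic_circle_continuous: "f \<in> analytic_circle \<Longrightarrow> continuous_on UNIV (lift_line f)"
  unfolding analytic_circle_def bdd_holo_def
  using continuous_lift_line holomorphic_annulus_continuous_sphere by blast


section \<open>Hyperfunctions and their Fourier coefficients\<close>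

lemma powi_holomorphic_punctured: "(\<lambda>z::complex. z powi k) holomorphic_on UNIV - {0}"
  by (auto intro!: holomorphic_intros)

lemma Laurent_polynomial_holomorphic:
  "(\<lambda>z::complex. \<Sum>k\<in>A. c k * z powi k) holomorphic_on UNIV - {0}"
  by (auto intro!: holomorphic_intros)

text \<open>The index changes sign because \<open>fourier_coeff H k\<close> tests \<open>H\<close>
  on the power \<open>- k\<close>.\<close>

lemma hyperfun_Laurent_polynomial:
  assumes H: "H \<in> hyperfun" and "finite A"
  shows "H (on_circle (\<lambda>z. \<Sum>k\<in>A. c k * z powi k)) = (\<Sum>k\<in>A. c k * fourier_coeff H (- k))"
  using assms(2)
proof induction
  case empty
  \<comment> \<open>That \<open>H\<close> vanishes at the zero function is read off from homogeneity
    with the scalar 0.\<close>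
  have "\<forall>a. \<forall>f\<in>analytic_circle. H (\<lambda>z. a * f z) = a * H f"
    using H by (simp add: hyperfun_def)
  from this[rule_format, of "on_circle (\<lambda>z. 0)" 0]
  have "H (\<lambda>z. 0 * on_circle (\<lambda>z. 0) z) = 0 * H (on_circle (\<lambda>z. 0))"
    using analytic_circle_punctured_plane[of "\<lambda>z. 0"] by simp
  then show ?case by (simp add: on_circle_def)
next
  case (insert k A)
  have an: "on_circle (\<lambda>z. z powi k) \<in> analytic_circle"
    "(\<lambda>z. c k * on_circle (\<lambda>z. z powi k) z) \<in> analytic_circle"
    "on_circle (\<lambda>z. \<Sum>k\<in>A. c k * z powi k) \<in> analytic_circle"
    by (intro analytic_circle_cmult analytic_circle_punctured_plane powi_holomorphic_punctured
        Laurent_polynomial_holomorphic)+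
  have "H (\<lambda>z. c k * on_circle (\<lambda>z. z powi k) z + on_circle (\<lambda>z. \<Sum>k\<in>A. c k * z powi k) z)
      = c k * H (on_circle (\<lambda>z. z powi k)) + H (on_circle (\<lambda>z. \<Sum>k\<in>A. c k * z powi k))"
    using H an unfolding hyperfun_def by simp
  then show ?case
    using insert by (simp add: on_circle_def fourier_coeff_def)
qed

text \<open>\<open>F\<close> is merely bounded on its annulus, so its Laurent series need not
  converge in the norm of radius \<open>l\<close>. It does so for any \<open>\<rho>\<close> strictly
  between 1 and \<open>l\<close>, and \<open>H\<close> is also bounded on the space of that
  radius.\<close>

theorem hyperfun_has_sum:
  assumes H: "H \<in> hyperfun" and l: "1 < l" and F: "F \<in> bdd_holo l"
  shows "((\<lambda>k. circle_coeff (on_circle F) k * fourier_coeff H (- k)) has_sum H (on_circle F)) UNIV"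
proof -
  let ?c = "circle_coeff (on_circle F)"
  have holF: "F holomorphic_on annulus l"
    using F by (simp add: bdd_holo_def)
  obtain \<rho> where \<rho>: "1 < \<rho>" "\<rho> < l" using l dense by blast
  obtain M where M: "((\<lambda>k. norm (?c k) * \<rho> ^ nat \<bar>k\<bar>) has_sum M) UNIV"
    using circle_coeff_abs_summable[OF holF, of \<rho>] \<rho> by (auto simp: summable_on_def)
  obtain C0 where C0: "\<And>F. F \<in> bdd_holo \<rho> \<Longrightarrow> norm (H (on_circle F)) \<le> C0 * qnorm \<rho> F"
    using H \<rho> unfolding hyperfun_def by blast
  \<comment> \<open>The constant supplied by continuity has no known sign; a positive one is wanted
    for dividing \<open>e\<close> by it.\<close>
  define C where "C = \<bar>C0\<bar> + 1"
  have C: "norm (H (on_circle F)) \<le> C * qnorm \<rho> F" if "F \<in> bdd_holo \<rho>" for F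
    using C0[OF that] mult_right_mono[OF _ qnorm_nonneg[OF \<rho>(1) that], of C0 C]
    by (simp add: C_def) linarith
  have "eventually (\<lambda>A. dist (\<Sum>k\<in>A. ?c k * fourier_coeff H (- k)) (H (on_circle F)) < e)
      (finite_subsets_at_top UNIV)" if "e > 0" for e
  proof -
    have "e / (C * 2) > 0" using that by (simp add: C_def)
    from has_sum_finite_subset_approx[OF M this] obtain Y where Y: "finite Y"
      "\<And>A. finite A \<Longrightarrow> Y \<subseteq> A \<Longrightarrow> dist (\<Sum>k\<in>A. norm (?c k) * \<rho> ^ nat \<bar>k\<bar>) M < e / (C * 2)"
      by blast
    have "dist (\<Sum>k\<in>A. ?c k * fourier_coeff H (- k)) (H (on_circle F)) < e"
      if A: "finite A" "Y \<subseteq> A" for A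
    proof -
      define P where "P = (\<lambda>z. \<Sum>k\<in>A. ?c k * z powi k)"
      have P: "P \<in> bdd_holo \<rho>"
        unfolding P_def by (intro bdd_holo_punctured_plane Laurent_polynomial_holomorphic)
      define G where "G = (\<lambda>z. F z + (-1) * P z)"
      have G: "G \<in> bdd_holo \<rho>"
        using \<rho> F P unfolding G_def by (intro bdd_holo_add bdd_holo_cmult bdd_holo_mono[of \<rho> l F]) auto
      have "norm (G z) \<le> e / (C * 2)" if z: "z \<in> annulus \<rho>" for z
      proof -
        have "((\<lambda>k. ?c k * z powi k) has_sum F z) UNIV"
          using circle_Laurent_expansion[OF holF l] annulus_mono[of \<rho> l] z \<rho> by auto
        then have "norm (F z - P z) \<le> M - (\<Sum>k\<in>A. norm (?c k) * \<rho> ^ nat \<bar>k\<bar>)"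
          unfolding P_def using z \<rho> A M by (intro Laurent_tail_bound) (auto simp: annulus_def)
        then show ?thesis
          using Y(2)[OF A] by (simp add: G_def dist_real_def)
      qed
      then have "qnorm \<rho> G \<le> e / (C * 2)"
        using \<rho> by (intro qnorm_least) auto
      then have "C * qnorm \<rho> G \<le> e / 2"
        by (simp add: C_def field_simps)
      then have "norm (H (on_circle G)) < e"
        using C[OF G] \<open>e > 0\<close> by linarith
      moreover have "H (on_circle F) = H (on_circle G) + H (on_circle P)"
      proof -
        have "on_circle G \<in> analytic_circle" "on_circle P \<in> analytic_circle"
          using G P \<rho> by (auto simp: analytic_circle_def)
        then have "H (\<lambda>z. on_circle G z + on_circle P z) = H (on_circle G) + H (on_circle P)"
          using H unfolding hyperfun_def by blast
        then show ?thesis by (simp add: on_circle_def G_def)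
      qed
      moreover have "H (on_circle P) = (\<Sum>k\<in>A. ?c k * fourier_coeff H (- k))"
        unfolding P_def by (rule hyperfun_Laurent_polynomial[OF H A(1)])
      ultimately show ?thesis
        by (simp add: dist_norm norm_minus_commute)
    qed
    then show ?thesis
      using Y(1) unfolding eventually_finite_subsets_at_top by blast
  qed
  then show ?thesis
    unfolding has_sum_def by (rule tendstoI)
qed

corollary hyperfun_eqI:
  assumes "H \<in> hyperfun" "K \<in> hyperfun" "fourier_coeff H = fourier_coeff K"
  shows "H = K"
proof
  fix f
  show "H f = K f"
  proof (cases "f \<in> analytic_circle")
    case True
    then obtain l F where "1 < l" "F \<in> bdd_holo l" "f = on_circle F"
      by (auto simp: analytic_circle_def)
    then show ?thesis
      using hyperfun_has_sum[OF assms(1)] hyperfun_has_sum[OF assms(2)] assms(3) has_sum_unique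
      by metis
  next
    case False
    then show ?thesis
      using assms by (auto simp: hyperfun_def extensional_def)
  qed
qed

text \<open>Continuity in the norm of radius \<open>l\<close> is tested on a single power, whose
  supremum on the annulus is at most \<open>l ^ |k|\<close>. As \<open>l\<close> may be any number
  above 1, the growth is subexponential.\<close>

lemma norm_fourier_coeff_le:
  assumes H: "H \<in> hyperfun" and "1 < l"
  obtains C where "C > 0" "\<And>k. norm (fourier_coeff H k) \<le> C * l ^ nat \<bar>k\<bar>"
proof -
  obtain C where C: "\<And>F. F \<in> bdd_holo l \<Longrightarrow> norm (H (on_circle F)) \<le> C * qnorm l F"
    using H \<open>1 < l\<close> unfolding hyperfun_def by blast
  have "norm (fourier_coeff H k) \<le> (\<bar>C\<bar> + 1) * l ^ nat \<bar>k\<bar>" for k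
  proof -
    have b: "(\<lambda>z. z powi - k) \<in> bdd_holo l"
      by (intro bdd_holo_punctured_plane powi_holomorphic_punctured)
    have "norm (fourier_coeff H k) \<le> C * qnorm l (\<lambda>z. z powi - k)"
      using C[OF b] by (simp add: fourier_coeff_def)
    also have "\<dots> \<le> (\<bar>C\<bar> + 1) * l ^ nat \<bar>k\<bar>"
    proof (rule mult_mono)
      show "qnorm l (\<lambda>z. z powi - k) \<le> l ^ nat \<bar>k\<bar>"
      proof (rule qnorm_least[OF \<open>1 < l\<close>])
        fix z assume "z \<in> annulus l"
        then show "norm (z powi - k) \<le> l ^ nat \<bar>k\<bar>"
          using norm_powi_le[of l z "- k"] \<open>1 < l\<close> by (auto simp: annulus_def)
      qed
      show "qnorm l (\<lambda>z. z powi - k) \<ge> 0"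
        by (rule qnorm_nonneg[OF \<open>1 < l\<close> b])
    qed auto
    finally show ?thesis .
  qed
  then show ?thesis
    using that[of "\<bar>C\<bar> + 1"] by auto
qed

text \<open>The functional is pairing with \<open>f\<close>, that is \<open>g\<close> goes to the
  mean of \<open>f * g\<close>. It is continuous because \<open>f\<close> is bounded on the circle,
  and \<open>hyperfun_eqI\<close> makes it the only hyperfunction with these coefficients, so the
  description in \<open>hyperfun_of\<close> denotes it.\<close>

lemma hyperfun_of_analytic:
  assumes f: "f \<in> analytic_circle"
  shows "hyperfun_of f \<in> hyperfun" "fourier_coeff (hyperfun_of f) = circle_coeff f"
proof -
  define H where "H = (\<lambda>g\<in>analytic_circle. circle_mean (\<lambda>z. f z * g z))"
  note cont = analytic_circle_continuous
  obtain B where B: "\<And>z. norm (f z) \<le> B"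
  proof -
    obtain l F where lF: "1 < l" "F \<in> bdd_holo l" "f = on_circle F"
      using f by (auto simp: analytic_circle_def)
    then have "norm (f z) \<le> qnorm l F" for z
      using qnorm_upper[of F l "point_of z"] unit_in_annulus by (simp add: on_circle_def)
    then show ?thesis by (rule that)
  qed
  have "H \<in> hyperfun"
    unfolding hyperfun_def
  proof (intro CollectI conjI ballI allI impI)
    show "H \<in> extensional analytic_circle" by (simp add: H_def)
  next
    fix g h assume gh: "g \<in> analytic_circle" "h \<in> analytic_circle"
    then show "H (\<lambda>z. g z + h z) = H g + H h"
      by (simp add: H_def analytic_circle_add distrib_left circle_mean_add cont analytic_circle_mult f)
  next
    fix a g assume "g \<in> analytic_circle"
    then show "H (\<lambda>z. a * g z) = a * H g"
      using circle_mean_cmult[of a "\<lambda>z. f z * g z"]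
      by (simp add: H_def analytic_circle_cmult mult.left_commute)
  next
    fix l :: real assume l: "1 < l"
    have "norm (H (on_circle G)) \<le> B * qnorm l G" if G: "G \<in> bdd_holo l" for G
    proof -
      have an: "on_circle G \<in> analytic_circle"
        using G l by (auto simp: analytic_circle_def)
      have "norm (on_circle G z) \<le> qnorm l G" for z
        using qnorm_upper[OF G, of "point_of z"] l unit_in_annulus by (simp add: on_circle_def)
      then have "norm (f z * on_circle G z) \<le> B * qnorm l G" for z
        unfolding norm_mult using B order_trans[OF norm_ge_zero B[of z]] by (intro mult_mono) auto
      then show ?thesis
        using an f by (simp add: H_def norm_circle_mean_le cont analytic_circle_mult)
    qed
    then show "\<exists>C. \<forall>G\<in>bdd_holo l. norm (H (on_circle G)) \<le> C * qnorm l G" by blast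
  qed
  moreover have "fourier_coeff H = circle_coeff f"
  proof
    fix k
    have "on_circle (\<lambda>z. z powi (- k)) \<in> analytic_circle"
      by (intro analytic_circle_punctured_plane powi_holomorphic_punctured)
    then show "fourier_coeff H k = circle_coeff f k"
      by (simp add: fourier_coeff_def H_def circle_coeff_def on_circle_def)
  qed
  ultimately have H: "H \<in> hyperfun \<and> fourier_coeff H = laurent_coeff f"
    using f by (simp add: laurent_coeff_eq_circle_coeff)
  have "hyperfun_of f \<in> hyperfun \<and> fourier_coeff (hyperfun_of f) = laurent_coeff f"
    unfolding hyperfun_of_def
  proof (rule theI[where a = H])
    show "H \<in> hyperfun \<and> fourier_coeff H = laurent_coeff f" by (rule H)
    show "K = H" if "K \<in> hyperfun \<and> fourier_coeff K = laurent_coeff f" for K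
      using that H by (intro hyperfun_eqI) auto
  qed
  then show "hyperfun_of f \<in> hyperfun" "fourier_coeff (hyperfun_of f) = circle_coeff f"
    using f by (auto simp: laurent_coeff_eq_circle_coeff)
qed

section \<open>Gevrey classes of order less than one\<close>

text \<open>Pulling back along \<open>exp (\<i> * w)\<close> turns an extension to an annulus into a
  periodic holomorphic function near the real line. Derivatives of the lift can then be computed as
  complex derivatives, and periodicity removes boundary terms.\<close>

lemma analytic_circle_strip:
  assumes "f \<in> analytic_circle"
  obtains S G where "open S" "\<And>t. of_real t \<in> S" "G holomorphic_on S"
    "\<And>w. w \<in> S \<Longrightarrow> w + of_real (2 * pi) \<in> S" "\<And>w. G (w + of_real (2 * pi)) = G w"
    "\<And>t. lift_line f t = G (of_real t)"
proof -
  obtain l F where F: "1 < l" "F holomorphic_on annulus l" "f = on_circle F"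
    using assms by (auto simp: analytic_circle_def bdd_holo_def)
  define S where "S = (\<lambda>w. exp (\<i> * w)) -` annulus l"
  define G where "G = F \<circ> (\<lambda>w. exp (\<i> * w))"
  have period: "exp (\<i> * (w + of_real (2 * pi))) = exp (\<i> * w)" for w
    by (simp add: distrib_left exp_add mult_ac)
  show ?thesis
  proof (rule that[of S G])
    show "open S"
      unfolding S_def by (intro open_vimage open_annulus continuous_intros)
    show "of_real t \<in> S" for t
      using F(1) by (simp add: S_def unit_in_annulus)
    show "G holomorphic_on S"
      unfolding G_def by (rule holomorphic_on_compose_gen[OF _ F(2)])
        (auto simp: S_def intro!: holomorphic_intros)
    show "w + of_real (2 * pi) \<in> S" if "w \<in> S" for w
      using that period[of w] by (simp add: S_def)
    show "G (w + of_real (2 * pi)) = G w" for w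
      using period[of w] by (simp add: G_def)
    show "lift_line f t = G (of_real t)" for t
      by (simp add: F(3) lift_line_on_circle G_def)
  qed
qed

text \<open>This opens the sum and product rules for higher complex derivatives to the real
  derivatives in the Gevrey condition.\<close>

lemma vderiv_eq_higher_deriv:
  assumes S: "open S" "\<And>t::real. of_real t \<in> S" and G: "G holomorphic_on S"
  shows "vderiv j (\<lambda>t. G (of_real t)) = (\<lambda>t. (deriv ^^ j) G (of_real t))"
proof (induction j)
  case 0
  then show ?case by (simp add: vderiv_def)
next
  case (Suc j)
  have "((deriv ^^ j) G has_field_derivative (deriv ^^ Suc j) G (of_real t)) (at (of_real t))" for t
    using holomorphic_derivI[OF holomorphic_higher_deriv[OF G S(1)] S(1) S(2), of j t] by simp
  from vector_derivative_at[OF has_vector_derivative_real_field[OF this]] Suc show ?case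
    by (simp add: vderiv_def)
qed

text \<open>The quotients are cleared and the bound is made nonnegative, so that bounds for two
  functions can be multiplied.\<close>

lemma gevrey_circle_iff:
  assumes "\<nu> > 0"
  shows "f \<in> gevrey_circle m \<nu> \<longleftrightarrow> f \<in> analytic_circle \<and>
    (\<exists>C\<ge>0. \<forall>t j. norm (vderiv j (lift_line f) t) \<le> C * (\<nu> ^ j * fact j powr m))"
    (is "_ \<longleftrightarrow> _ \<and> ?R")
proof -
  let ?q = "\<lambda>(t::real, j::nat). norm (vderiv j (lift_line f) t) / (\<nu> ^ j * fact j powr m)"
  have pos: "\<nu> ^ j * fact j powr m > (0::real)" for j :: nat
    using assms by simp
  have "bdd_above (range ?q) \<longleftrightarrow> (\<exists>C\<ge>0. \<forall>x. ?q x \<le> C)"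
  proof
    assume "bdd_above (range ?q)"
    then obtain C where "\<forall>x. ?q x \<le> C" by (auto simp: bdd_above_def)
    then show "\<exists>C\<ge>0. \<forall>x. ?q x \<le> C" by (intro exI[of _ "max 0 C"]) (auto intro: le_max_iff_disj[THEN iffD2])
  qed (auto simp: bdd_above_def)
  also have "\<dots> \<longleftrightarrow> ?R"
    using pos by (simp add: pos_divide_le_eq split_paired_All)
  finally show ?thesis
    by (auto simp: gevrey_circle_def)
qed

text \<open>As \<open>fact j \<ge> 1\<close>, raising \<open>m\<close> weakens the condition. Two
  functions thus share the class of the larger parameters, and the maximum of two orders below 1 is
  still below 1.\<close>

lemma gevrey_circle_mono:
  assumes "m \<le> m'" "0 < \<nu>" "\<nu> \<le> \<nu>'" and f: "f \<in> gevrey_circle m \<nu>"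
  shows "f \<in> gevrey_circle m' \<nu>'"
proof -
  obtain C where C: "C \<ge> 0" "\<And>t j. norm (vderiv j (lift_line f) t) \<le> C * (\<nu> ^ j * fact j powr m)"
    using f gevrey_circle_iff[OF assms(2)] by auto
  have "norm (vderiv j (lift_line f) t) \<le> C * (\<nu>' ^ j * fact j powr m')" for t j
  proof -
    have "\<nu> ^ j * fact j powr m \<le> \<nu>' ^ j * fact j powr m'"
      using assms by (intro mult_mono power_mono powr_mono) auto
    then show ?thesis
      using C(2)[of j t] mult_left_mono[OF _ C(1)] order_trans by blast
  qed
  then show ?thesis
    using assms f C(1) by (auto simp: gevrey_circle_iff)
qed

lemma A1_circle_pair:
  assumes "f \<in> A1_circle" "g \<in> A1_circle"
  obtains m \<nu> where "0 \<le> m" "m < 1" "0 < \<nu>" "f \<in> gevrey_circle m \<nu>" "g \<in> gevrey_circle m \<nu>"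
proof -
  obtain m1 n1 m2 n2 where *: "0 \<le> m1" "m1 < 1" "0 < n1" "f \<in> gevrey_circle m1 n1"
    "0 \<le> m2" "m2 < 1" "0 < n2" "g \<in> gevrey_circle m2 n2"
    using assms unfolding A1_circle_def by auto
  show ?thesis
    by (rule that[of "max m1 m2" "max n1 n2"])
       (use * gevrey_circle_mono[of m1 "max m1 m2" n1 "max n1 n2" f]
          gevrey_circle_mono[of m2 "max m1 m2" n2 "max n1 n2" g] in auto)
qed

lemma A1_circle_analytic: "f \<in> A1_circle \<Longrightarrow> f \<in> analytic_circle"
  by (auto simp: A1_circle_def gevrey_circle_def)

lemma A1_circleI: "0 \<le> m \<Longrightarrow> m < 1 \<Longrightarrow> 0 < \<nu> \<Longrightarrow> f \<in> gevrey_circle m \<nu> \<Longrightarrow> f \<in> A1_circle"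
  by (auto simp: A1_circle_def)

lemma A1_circle_add:
  assumes "f \<in> A1_circle" "g \<in> A1_circle"
  shows "(\<lambda>z. f z + g z) \<in> A1_circle"
proof -
  obtain m \<nu> where m: "0 \<le> m" "m < 1" "0 < \<nu>" and fg: "f \<in> gevrey_circle m \<nu>" "g \<in> gevrey_circle m \<nu>"
    using assms by (rule A1_circle_pair)
  obtain C where C: "C \<ge> 0" "\<And>t j. norm (vderiv j (lift_line f) t) \<le> C * (\<nu> ^ j * fact j powr m)"
    using fg(1) gevrey_circle_iff[OF m(3)] by auto
  obtain D where D: "D \<ge> 0" "\<And>t j. norm (vderiv j (lift_line g) t) \<le> D * (\<nu> ^ j * fact j powr m)"
    using fg(2) gevrey_circle_iff[OF m(3)] by auto
  obtain S G where G: "open S" "\<And>t. of_real t \<in> S" "G holomorphic_on S"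
    "\<And>t. lift_line f t = G (of_real t)"
    using analytic_circle_strip[OF A1_circle_analytic[OF assms(1)]] by metis
  obtain T K where K: "open T" "\<And>t. of_real t \<in> T" "K holomorphic_on T"
    "\<And>t. lift_line g t = K (of_real t)"
    using analytic_circle_strip[OF A1_circle_analytic[OF assms(2)]] by metis
  have U: "open (S \<inter> T)" "\<And>t. of_real t \<in> S \<inter> T" "G holomorphic_on S \<inter> T" "K holomorphic_on S \<inter> T"
    using G K by (auto intro: holomorphic_on_subset)
  have "vderiv j (lift_line (\<lambda>z. f z + g z)) t
      = vderiv j (lift_line f) t + vderiv j (lift_line g) t" for j t
  proof -
    have "lift_line (\<lambda>z. f z + g z) = (\<lambda>t. G (of_real t) + K (of_real t))"
      "lift_line f = (\<lambda>t. G (of_real t))" "lift_line g = (\<lambda>t. K (of_real t))"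
      using G(4) K(4) by (auto simp: lift_line_def)
    then show ?thesis
      using vderiv_eq_higher_deriv[OF U(1,2,3), of j] vderiv_eq_higher_deriv[OF U(1,2,4), of j]
        vderiv_eq_higher_deriv[OF U(1,2) holomorphic_on_add[OF U(3,4)], of j]
        higher_deriv_add[OF U(3,4,1,2), of j t]
      by simp
  qed
  then have "norm (vderiv j (lift_line (\<lambda>z. f z + g z)) t) \<le> (C + D) * (\<nu> ^ j * fact j powr m)" for j t
    using norm_triangle_mono[OF C(2)[of j t] D(2)[of j t]] by (simp add: distrib_right)
  then have "(\<lambda>z. f z + g z) \<in> gevrey_circle m \<nu>"
    using C(1) D(1) assms m
    by (auto simp: gevrey_circle_iff analytic_circle_add A1_circle_analytic intro!: exI[of _ "C + D"])
  then show ?thesis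
    using m by (intro A1_circleI)
qed

text \<open>In the Leibniz rule \<open>fact i * fact (j - i) \<le> fact j\<close>, since binomial
  coefficients are at least 1, and raising this to the power \<open>m \<ge> 0\<close> keeps the
  order. The binomial coefficients add up to \<open>2 ^ j\<close>, which only doubles
  \<open>\<nu>\<close>.\<close>

lemma A1_circle_mult:
  assumes "f \<in> A1_circle" "g \<in> A1_circle"
  shows "(\<lambda>z. f z * g z) \<in> A1_circle"
proof -
  obtain m \<nu> where m: "0 \<le> m" "m < 1" "0 < \<nu>" and fg: "f \<in> gevrey_circle m \<nu>" "g \<in> gevrey_circle m \<nu>"
    using assms by (rule A1_circle_pair)
  obtain C where C: "C \<ge> 0" "\<And>t j. norm (vderiv j (lift_line f) t) \<le> C * (\<nu> ^ j * fact j powr m)"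
    using fg(1) gevrey_circle_iff[OF m(3)] by auto
  obtain D where D: "D \<ge> 0" "\<And>t j. norm (vderiv j (lift_line g) t) \<le> D * (\<nu> ^ j * fact j powr m)"
    using fg(2) gevrey_circle_iff[OF m(3)] by auto
  obtain S G where G: "open S" "\<And>t. of_real t \<in> S" "G holomorphic_on S"
    "\<And>t. lift_line f t = G (of_real t)"
    using analytic_circle_strip[OF A1_circle_analytic[OF assms(1)]] by metis
  obtain T K where K: "open T" "\<And>t. of_real t \<in> T" "K holomorphic_on T"
    "\<And>t. lift_line g t = K (of_real t)"
    using analytic_circle_strip[OF A1_circle_analytic[OF assms(2)]] by metis
  have U: "open (S \<inter> T)" "\<And>t. of_real t \<in> S \<inter> T" "G holomorphic_on S \<inter> T" "K holomorphic_on S \<inter> T"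
    using G K by (auto intro: holomorphic_on_subset)
  have leibniz: "vderiv j (lift_line (\<lambda>z. f z * g z)) t
      = (\<Sum>i=0..j. of_nat (j choose i) * vderiv i (lift_line f) t * vderiv (j - i) (lift_line g) t)" for j t
  proof -
    have "lift_line (\<lambda>z. f z * g z) = (\<lambda>t. G (of_real t) * K (of_real t))"
      "lift_line f = (\<lambda>t. G (of_real t))" "lift_line g = (\<lambda>t. K (of_real t))"
      using G(4) K(4) by (auto simp: lift_line_def)
    then show ?thesis
      using vderiv_eq_higher_deriv[OF U(1,2,3)] vderiv_eq_higher_deriv[OF U(1,2,4)]
        vderiv_eq_higher_deriv[OF U(1,2) holomorphic_on_mult[OF U(3,4)], of j]
        higher_deriv_mult[OF U(3,4,1,2), of j t]
      by simp
  qed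
  have "norm (vderiv j (lift_line (\<lambda>z. f z * g z)) t) \<le> C * D * ((2 * \<nu>) ^ j * fact j powr m)" for j t
  proof -
    let ?B = "C * D * \<nu> ^ j * fact j powr m"
    have "norm (of_nat (j choose i) * vderiv i (lift_line f) t * vderiv (j - i) (lift_line g) t)
        \<le> of_nat (j choose i) * ?B" if "i \<in> {0..j}" for i
    proof -
      have "fact i * fact (j - i) * real (j choose i) = fact j"
        using that binomial_fact_lemma[of i j]
        by (metis atLeastAtMost_iff of_nat_fact of_nat_mult)
      moreover have "real (j choose i) \<ge> 1"
        using that by (simp add: Suc_leI)
      ultimately have "fact i * fact (j - i) \<le> (fact j :: real)"
        using mult_left_mono[of 1 "real (j choose i)" "fact i * fact (j - i)"] by simp
      then have f: "fact i powr m * fact (j - i) powr m \<le> (fact j powr m :: real)"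
        using m by (simp add: powr_mult [symmetric] powr_mono2)
      have "norm (vderiv i (lift_line f) t) * norm (vderiv (j - i) (lift_line g) t)
          \<le> (C * (\<nu> ^ i * fact i powr m)) * (D * (\<nu> ^ (j - i) * fact (j - i) powr m))"
        using C D m by (intro mult_mono) auto
      also have "\<dots> = C * D * (\<nu> ^ i * \<nu> ^ (j - i)) * (fact i powr m * fact (j - i) powr m)"
        by (simp add: mult_ac)
      also have "\<dots> = C * D * \<nu> ^ j * (fact i powr m * fact (j - i) powr m)"
        using that by (simp add: power_add [symmetric])
      also have "\<dots> \<le> ?B"
        using C D m by (intro mult_left_mono f) auto
      finally show ?thesis
        by (simp add: norm_mult mult.assoc mult_left_mono)
    qed
    then have "norm (vderiv j (lift_line (\<lambda>z. f z * g z)) t) \<le> (\<Sum>i=0..j. of_nat (j choose i) * ?B)"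
      unfolding leibniz by (rule sum_norm_le)
    also have "\<dots> = 2 ^ j * ?B"
      using choose_row_sum[of j]
      by (simp add: sum_distrib_right [symmetric] atLeast0AtMost flip: of_nat_sum)
    finally show ?thesis
      by (simp add: power_mult_distrib mult_ac)
  qed
  then have "(\<lambda>z. f z * g z) \<in> gevrey_circle m (2 * \<nu>)"
    using C(1) D(1) assms m
    by (auto simp: gevrey_circle_iff analytic_circle_mult A1_circle_analytic intro!: exI[of _ "C * D"])
  then show ?thesis
    using m by (intro A1_circleI[of m "2 * \<nu>"]) auto
qed

text \<open>On the line this is an exponential, whose derivatives grow like \<open>|k| ^ j\<close>
  without a factorial, so the order is 0. The added 1 keeps \<open>\<nu>\<close> positive when
  \<open>k = 0\<close>.\<close>

lemma A1_circle_powi: "on_circle (\<lambda>z. z powi k) \<in> A1_circle"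
proof -
  define a :: complex where "a = \<i> * of_int k"
  have lift: "lift_line (on_circle (\<lambda>z. z powi k)) = (\<lambda>t. exp (a * of_real t))"
    using exp_power_int[of "\<i> * of_real _" k] by (auto simp: lift_line_on_circle a_def mult_ac)
  have "vderiv j (\<lambda>t. exp (a * of_real t)) = (\<lambda>t. a ^ j * exp (a * of_real t))" for j
  proof (induction j)
    case 0
    then show ?case by (simp add: vderiv_def)
  next
    case (Suc j)
    have "((\<lambda>w. a ^ j * exp (a * w)) has_field_derivative a ^ Suc j * exp (a * of_real t)) (at (of_real t))" for t
      by (auto intro!: derivative_eq_intros)
    from vector_derivative_at[OF has_vector_derivative_real_field[OF this]] Suc show ?case
      by (simp add: vderiv_def)
  qed
  moreover have "norm (a ^ j * exp (a * of_real t)) \<le> 1 * ((\<bar>of_int k\<bar> + 1) ^ j * fact j powr 0)" for j t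
    by (simp add: a_def norm_mult norm_power power_mono)
  ultimately have "on_circle (\<lambda>z. z powi k) \<in> gevrey_circle 0 (\<bar>of_int k\<bar> + 1)"
    unfolding gevrey_circle_iff[of "\<bar>of_int k\<bar> + 1"]
    by (subst gevrey_circle_iff)
       (auto simp: lift analytic_circle_punctured_plane powi_holomorphic_punctured intro!: exI[of _ 1])
  then show ?thesis
    by (intro A1_circleI[of 0 "\<bar>of_int k\<bar> + 1"]) auto
qed

lemma A1_circle_const: "(\<lambda>z. a) \<in> A1_circle"
proof -
  have "vderiv j (\<lambda>t. a) = (\<lambda>t. if j = 0 then a else 0)" for j
    by (induction j) (auto simp: vderiv_def)
  moreover have "lift_line (\<lambda>z. a) = (\<lambda>t. a)"
    by (auto simp: lift_line_def)
  moreover have "(\<lambda>z. a) \<in> analytic_circle"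
    using analytic_circle_punctured_plane[of "\<lambda>z. a"] by (simp add: on_circle_def)
  ultimately have "(\<lambda>z. a) \<in> gevrey_circle 0 1"
    by (auto simp: gevrey_circle_iff intro!: exI[of _ "norm a"])
  then show ?thesis
    by (intro A1_circleI[of 0 1]) auto
qed

lemma A1_circle_cmult: "f \<in> A1_circle \<Longrightarrow> (\<lambda>z. a * f z) \<in> A1_circle"
  by (intro A1_circle_mult A1_circle_const)

lemma A1_circle_Laurent_polynomial:
  "on_circle (\<lambda>z. \<Sum>k\<in>A. c k * z powi k) \<in> A1_circle"
proof (cases "finite A")
  case True
  then show ?thesis
  proof induction
    case empty
    then show ?case by (simp add: on_circle_def A1_circle_const)
  next
    case (insert k A)
    then show ?case
      using A1_circle_add[OF A1_circle_cmult[OF A1_circle_powi[of k], of "c k"] insert.IH]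
      by (simp add: on_circle_def)
  qed
\<comment> \<open>A sum over an infinite index set is 0 by convention, hence constant.\<close>
qed (simp add: on_circle_def A1_circle_const)

section \<open>Coefficient decay and extension to the punctured plane\<close>

lemma circle_coeff_higher_derivative_bound:
  assumes f: "f \<in> analytic_circle" and B: "\<And>t. norm (vderiv j (lift_line f) t) \<le> B"
  shows "norm (circle_coeff f k) * \<bar>of_int k\<bar> ^ j \<le> B"
proof -
  obtain S G where S: "open S" "\<And>t. of_real t \<in> S" and G: "G holomorphic_on S"
    and per: "\<And>w. w \<in> S \<Longrightarrow> w + of_real (2 * pi) \<in> S" "\<And>w. G (w + of_real (2 * pi)) = G w"
    and lift: "\<And>t. lift_line f t = G (of_real t)"
    using analytic_circle_strip[OF f] by metis
  define e where "e = (\<lambda>w. exp (- (\<i> * of_int k * w)))"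
  have e_norm: "norm (e (of_real t)) = 1" for t
    by (simp add: e_def)
  have e_per: "e (of_real (2 * pi)) = e 0"
    using exp_integer_2pi[of "of_int (- k)"] by (simp add: e_def mult_ac)
  \<comment> \<open>Translation by the period leaves \<open>G\<close> unchanged as a function, so
    differentiating the translate carries periodicity over to all derivatives.\<close>
  have G_per: "(deriv ^^ j) G (of_real (2 * pi)) = (deriv ^^ j) G 0" for j
  proof -
    have "(deriv ^^ j) (\<lambda>w. G (1 * w + of_real (2 * pi))) 0 = 1 ^ j * (deriv ^^ j) G (1 * 0 + of_real (2 * pi))"
      by (rule higher_deriv_compose_linear'[OF G S(1) S(1)]) (use per S(2)[of 0] in auto)
    then show ?thesis using per(2) by simp
  qed
  define I where "I = (\<lambda>j. integral {0..2 * pi} (\<lambda>t. (deriv ^^ j) G (of_real t) * e (of_real t)))"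
  have integrable: "(\<lambda>t. (deriv ^^ j) G (of_real t) * e (of_real t)) integrable_on {0..2 * pi}" for j
  proof (intro integrable_continuous_real continuous_on_mult)
    show "continuous_on {0..2 * pi} (\<lambda>t. (deriv ^^ j) G (of_real t))"
      by (rule continuous_on_compose2[OF holomorphic_on_imp_continuous_on[OF holomorphic_higher_deriv[OF G S(1)]]])
        (use S(2) in \<open>auto intro!: continuous_intros\<close>)
    show "continuous_on {0..2 * pi} (\<lambda>t. e (of_real t))"
      unfolding e_def by (intro continuous_intros)
  qed
  \<comment> \<open>Integration by parts: the derivative of \<open>(deriv ^^ j) G * e\<close>
    integrates to the difference of end values, which vanishes because both factors are
    periodic.\<close>
  have step: "I (Suc j) = \<i> * of_int k * I j" for j
  proof -
    have "((\<lambda>t. (deriv ^^ Suc j) G (of_real t) * e (of_real t)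
        - \<i> * of_int k * ((deriv ^^ j) G (of_real t) * e (of_real t))) has_integral
        ((deriv ^^ j) G (of_real (2 * pi)) * e (of_real (2 * pi))
         - (deriv ^^ j) G (of_real 0) * e (of_real 0))) {0..2 * pi}"
    proof (rule fundamental_theorem_of_calculus)
      fix t :: real
      have "((deriv ^^ j) G has_field_derivative (deriv ^^ Suc j) G (of_real t)) (at (of_real t))"
        using holomorphic_derivI[OF holomorphic_higher_deriv[OF G S(1)] S(1) S(2), of j t] by simp
      moreover have "(e has_field_derivative (- (\<i> * of_int k) * e (of_real t))) (at (of_real t))"
        unfolding e_def by (auto intro!: derivative_eq_intros)
      ultimately have "((\<lambda>w. (deriv ^^ j) G w * e w) has_field_derivative
          (deriv ^^ Suc j) G (of_real t) * e (of_real t)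
          - \<i> * of_int k * ((deriv ^^ j) G (of_real t) * e (of_real t))) (at (of_real t))"
        by (auto intro!: derivative_eq_intros)
      from has_vector_derivative_real_field[OF this]
      show "((\<lambda>t. (deriv ^^ j) G (of_real t) * e (of_real t)) has_vector_derivative
          (deriv ^^ Suc j) G (of_real t) * e (of_real t)
          - \<i> * of_int k * ((deriv ^^ j) G (of_real t) * e (of_real t))) (at t within {0..2 * pi})" .
    qed simp
    from has_integral_unique[OF this, of "I (Suc j) - \<i> * of_int k * I j"]
    have "I (Suc j) - \<i> * of_int k * I j = 0"
      if "((\<lambda>t. (deriv ^^ Suc j) G (of_real t) * e (of_real t)
        - \<i> * of_int k * ((deriv ^^ j) G (of_real t) * e (of_real t))) has_integral
        (I (Suc j) - \<i> * of_int k * I j)) {0..2 * pi}"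
      using that by (simp only: G_per e_per of_real_0) simp
    moreover have "((\<lambda>t. (deriv ^^ Suc j) G (of_real t) * e (of_real t)
        - \<i> * of_int k * ((deriv ^^ j) G (of_real t) * e (of_real t))) has_integral
        (I (Suc j) - \<i> * of_int k * I j)) {0..2 * pi}"
      unfolding I_def
      by (intro has_integral_diff has_integral_mult_right integrable_integral integrable)
    ultimately have "I (Suc j) - \<i> * of_int k * I j = 0"
      by blast
    then show ?thesis by simp
  qed
  \<comment> \<open>Keeping the powers of \<open>k\<close> on this side avoids a division, so
    \<open>k = 0\<close> is no special case.\<close>
  have I: "I j = (\<i> * of_int k) ^ j * I 0"
    by (induction j) (simp_all add: step)
  have "norm (I j) \<le> B * (2 * pi - 0)"
    unfolding I_def
  proof (rule integral_bound)
    show "continuous_on {0..2 * pi} (\<lambda>t. (deriv ^^ j) G (of_real t) * e (of_real t))"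
      unfolding e_def
      by (intro continuous_intros continuous_on_compose2[OF holomorphic_on_imp_continuous_on[OF holomorphic_higher_deriv[OF G S(1)]]])
        (use S(2) in \<open>auto intro!: continuous_intros\<close>)
    have "lift_line f = (\<lambda>t. G (of_real t))" using lift by auto
    then show "norm ((deriv ^^ j) G (of_real t) * e (of_real t)) \<le> B" for t
      using B by (simp add: norm_mult e_norm vderiv_eq_higher_deriv[OF S G])
  qed simp
  moreover have "circle_coeff f k = I 0 / (2 * pi)"
  proof -
    have "lift_line (\<lambda>z. f z * point_of z powi - k) = (\<lambda>t. (deriv ^^ 0) G (of_real t) * e (of_real t))"
      by (rule ext) (simp add: lift_line_circle_coeff_integrand lift e_def)
    then show ?thesis
      by (simp add: circle_coeff_def circle_mean_def I_def)
  qed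
  moreover have "norm (I j) = \<bar>of_int k\<bar> ^ j * norm (I 0)"
    by (subst I) (simp add: norm_mult norm_power)
  moreover have "norm (I 0) = 2 * pi * norm (circle_coeff f k)"
    unfolding \<open>circle_coeff f k = I 0 / (2 * pi)\<close> by (simp add: norm_divide)
  ultimately have "2 * pi * (norm (circle_coeff f k) * \<bar>of_int k\<bar> ^ j) \<le> 2 * pi * B"
    by (simp add: mult_ac)
  then show ?thesis
    by simp
qed

text \<open>The ratio of consecutive terms is \<open>|x|\<close> times
  \<open>(n + 1) powr (m - 1)\<close>, which tends to 0 for every \<open>x\<close> precisely because
  the exponent is negative.\<close>

lemma summable_power_fact_powr:
  assumes "m < 1"
  shows "summable (\<lambda>j. x ^ j * fact j powr (m - 1) :: real)"
proof -
  have "((\<lambda>n. \<bar>x\<bar> * real (Suc n) powr (m - 1)) \<longlongrightarrow> \<bar>x\<bar> * 0) sequentially"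
    using assms
    by (intro tendsto_mult_left tendsto_neg_powr filterlim_compose[OF filterlim_real_sequentially filterlim_Suc]) auto
  then have "eventually (\<lambda>n. \<bar>x\<bar> * real (Suc n) powr (m - 1) < 1 / 2) sequentially"
    by (rule order_tendstoD) simp
  then obtain N where N: "\<And>n. n \<ge> N \<Longrightarrow> \<bar>x\<bar> * real (Suc n) powr (m - 1) < 1 / 2"
    by (auto simp: eventually_sequentially)
  show ?thesis
  proof (rule summable_ratio_test)
    fix n assume "n \<ge> N"
    have "norm (x ^ Suc n * fact (Suc n) powr (m - 1))
        = (\<bar>x\<bar> * real (Suc n) powr (m - 1)) * norm (x ^ n * fact n powr (m - 1))"
      by (simp add: abs_mult power_abs powr_mult del: of_nat_Suc)
    also have "\<dots> \<le> 1 / 2 * norm (x ^ n * fact n powr (m - 1))"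
      using N[OF \<open>n \<ge> N\<close>] by (intro mult_right_mono) auto
    finally show "norm (x ^ Suc n * fact (Suc n) powr (m - 1)) \<le> 1 / 2 * norm (x ^ n * fact n powr (m - 1))" .
  qed simp
qed

lemma A1_circle_coeff_exp_decay:
  assumes f: "f \<in> A1_circle" and "s \<ge> 0"
  obtains M where "\<And>k. norm (circle_coeff f k) * exp (s * \<bar>of_int k\<bar>) \<le> M"
proof -
  obtain m \<nu> where m: "0 \<le> m" "m < 1" "0 < \<nu>" and "f \<in> gevrey_circle m \<nu>"
    using A1_circle_pair[OF f f] by blast
  then obtain C where C: "C \<ge> 0" "\<And>t j. norm (vderiv j (lift_line f) t) \<le> C * (\<nu> ^ j * fact j powr m)"
    using gevrey_circle_iff[OF m(3)] by auto
  \<comment> \<open>The majorant does not involve \<open>k\<close>, so its sum is a bound common to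
    all coefficients.\<close>
  define a where "a = (\<lambda>j. C * ((s * \<nu>) ^ j * fact j powr (m - 1)))"
  have sum_a: "summable a"
    unfolding a_def using m by (intro summable_mult summable_power_fact_powr)
  have "norm (circle_coeff f k) * exp (s * \<bar>of_int k\<bar>) \<le> suminf a" for k
  proof -
    have e: "(\<lambda>j. norm (circle_coeff f k) * ((s * \<bar>of_int k\<bar>) ^ j /\<^sub>R fact j)) sums
        (norm (circle_coeff f k) * exp (s * \<bar>of_int k\<bar>))"
      by (intro sums_mult exp_converges)
    have "norm (circle_coeff f k) * ((s * \<bar>of_int k\<bar>) ^ j /\<^sub>R fact j) \<le> a j" for j
    proof -
      have "norm (circle_coeff f k) * ((s * \<bar>of_int k\<bar>) ^ j /\<^sub>R fact j)
          = (norm (circle_coeff f k) * \<bar>of_int k\<bar> ^ j) * (s ^ j / fact j)"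
        by (simp add: power_mult_distrib divide_inverse mult_ac)
      also have "\<dots> \<le> (C * (\<nu> ^ j * fact j powr m)) * (s ^ j / fact j)"
        using circle_coeff_higher_derivative_bound[OF A1_circle_analytic[OF f] C(2)] \<open>s \<ge> 0\<close>
        by (intro mult_right_mono) auto
      also have "\<dots> = a j"
        by (simp add: a_def power_mult_distrib powr_diff mult_ac)
      finally show ?thesis .
    qed
    from sums_le[OF this e summable_sums[OF sum_a]] show ?thesis .
  qed
  then show ?thesis by (rule that)
qed

lemma summable_power_nat_abs:
  assumes "0 \<le> x" "x < 1"
  shows "(\<lambda>k::int. x ^ nat \<bar>k\<bar> :: real) summable_on UNIV"
proof -
  have 1: "((\<lambda>n. x ^ n) has_sum (1 / (1 - x))) UNIV"
    using assms by (intro norm_summable_imp_has_sum geometric_sums) (auto intro!: summable_geometric)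
  have 2: "((\<lambda>n. x ^ Suc n) has_sum (x * (1 / (1 - x)))) UNIV"
    unfolding power_Suc by (intro has_sum_cmult_right 1)
  have "nat \<bar>int n\<bar> = n" "nat \<bar>- int (Suc n)\<bar> = Suc n" for n
    by auto
  then have "((\<lambda>k::int. x ^ nat \<bar>k\<bar>) has_sum (1 / (1 - x) + x * (1 / (1 - x)))) UNIV"
    using 1 2 by (intro has_sum_int_from_nat) (simp_all only:)
  then show ?thesis
    by (rule has_sum_imp_summable)
qed

text \<open>The decay rate is taken as \<open>ln (2 * \<rho>)\<close>: the coefficients are then at
  most \<open>M / (2 * \<rho>) ^ |k|\<close>, and a geometric series of ratio 1/2 remains after
  weighting.\<close>

lemma A1_circle_coeff_summable:
  assumes f: "f \<in> A1_circle" and "1 \<le> \<rho>"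
  shows "(\<lambda>k. norm (circle_coeff f k) * \<rho> ^ nat \<bar>k\<bar>) summable_on UNIV"
proof -
  have e: "exp (ln (2 * \<rho>) * \<bar>of_int k\<bar>) = (2 * \<rho>) ^ nat \<bar>k\<bar>" for k :: int
  proof -
    have "exp (ln (2 * \<rho>) * \<bar>of_int k\<bar>) = exp (real (nat \<bar>k\<bar>) * ln (2 * \<rho>))"
      by (simp add: mult.commute)
    also have "\<dots> = (2 * \<rho>) ^ nat \<bar>k\<bar>"
      unfolding exp_of_nat_mult using assms by simp
    finally show ?thesis .
  qed
  obtain M where M: "\<And>k. norm (circle_coeff f k) * exp (ln (2 * \<rho>) * \<bar>of_int k\<bar>) \<le> M"
    using A1_circle_coeff_exp_decay[OF f, of "ln (2 * \<rho>)"] assms by auto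
  have "(\<lambda>k::int. M * (1 / 2) ^ nat \<bar>k\<bar>) summable_on UNIV"
    by (intro summable_on_cmult_right summable_power_nat_abs) auto
  then show ?thesis
  proof (rule summable_on_comparison_test)
    fix k :: int
    show "norm (circle_coeff f k) * \<rho> ^ nat \<bar>k\<bar> \<le> M * (1 / 2) ^ nat \<bar>k\<bar>"
      using M[of k] unfolding e by (simp add: power_mult_distrib power_divide field_simps)
  qed (use assms in auto)
qed

text \<open>The radius exceeds 1, \<open>norm z\<close> and \<open>1 / norm z\<close> at once. The
  annuli therefore exhaust the punctured plane.\<close>

lemma point_in_annulus:
  assumes "z \<noteq> 0"
  shows "1 < norm z + 1 / norm z + 1" "z \<in> annulus (norm z + 1 / norm z + 1)"
proof -
  define n where "n = norm z"
  have pos: "n > 0" "1 / n > 0" using assms by (auto simp: n_def)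
  have "n * (n + 1 / n + 1) = n * n + 1 + n"
    using pos by (simp add: distrib_left)
  then have "1 < n * (n + 1 / n + 1)"
    using pos by (simp add: add_pos_pos)
  moreover have "0 < n + 1 / n + 1" using pos by linarith
  ultimately have "1 / (n + 1 / n + 1) < n"
    by (simp only: pos_divide_less_eq)
  moreover have "n < n + 1 / n + 1" "1 < n + 1 / n + 1"
    using pos by linarith+
  ultimately show "1 < norm z + 1 / norm z + 1" "z \<in> annulus (norm z + 1 / norm z + 1)"
    by (simp_all only: annulus_def n_def mem_Collect_eq)
qed

text \<open>The Laurent series of \<open>f\<close> converges on every annulus, uniformly along the
  finite index sets, by the weighted summability for all \<open>\<rho>\<close>. One formula serves
  all radii, so differentiability at each point glues the annuli together.\<close>

lemma A1_circle_extension: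
  assumes f: "f \<in> A1_circle"
  shows "\<exists>F. F holomorphic_on UNIV - {0} \<and> f = on_circle F"
proof -
  define F where "F = (\<lambda>z. \<Sum>\<^sub>\<infinity>k. circle_coeff f k * z powi k)"
  have hol: "F holomorphic_on annulus \<rho> \<and> (\<forall>z\<in>annulus \<rho>. ((\<lambda>k. circle_coeff f k * z powi k) has_sum F z) UNIV)"
    if \<rho>: "1 < \<rho>" for \<rho>
  proof -
    obtain M where M: "((\<lambda>k. norm (circle_coeff f k) * \<rho> ^ nat \<bar>k\<bar>) has_sum M) UNIV"
      using A1_circle_coeff_summable[OF f, of \<rho>] \<rho> by (auto simp: summable_on_def)
    have sum: "((\<lambda>k. circle_coeff f k * z powi k) has_sum F z) UNIV" if z: "z \<in> annulus \<rho>" for z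
    proof -
      have "(\<lambda>k. norm (circle_coeff f k * z powi k)) summable_on UNIV"
        using has_sum_imp_summable[OF M]
      proof (rule summable_on_comparison_test)
        fix k
        have "norm (z powi k) \<le> \<rho> ^ nat \<bar>k\<bar>"
          using z \<rho> by (intro norm_powi_le) (auto simp: annulus_def)
        then show "norm (circle_coeff f k * z powi k) \<le> norm (circle_coeff f k) * \<rho> ^ nat \<bar>k\<bar>"
          by (simp add: norm_mult mult_left_mono)
      qed simp
      then show ?thesis
        unfolding F_def by (rule has_sum_infsum[OF abs_summable_summable])
    qed
    have unif: "uniform_limit (annulus \<rho>) (\<lambda>A z. \<Sum>k\<in>A. circle_coeff f k * z powi k) F (finite_subsets_at_top UNIV)"
    proof (rule uniform_limitI)
      fix e :: real assume "e > 0"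
      from has_sum_finite_subset_approx[OF M this] obtain Y where Y: "finite Y"
        "\<And>A. finite A \<Longrightarrow> Y \<subseteq> A \<Longrightarrow> dist (\<Sum>k\<in>A. norm (circle_coeff f k) * \<rho> ^ nat \<bar>k\<bar>) M < e"
        by blast
      have "dist (\<Sum>k\<in>A. circle_coeff f k * z powi k) (F z) < e"
        if A: "finite A" "Y \<subseteq> A" and z: "z \<in> annulus \<rho>" for A z
      proof -
        have "1 \<le> \<rho>" "1 / \<rho> \<le> norm z" "norm z \<le> \<rho>"
          using z \<rho> by (simp_all add: annulus_def)
        then have "norm (F z - (\<Sum>k\<in>A. circle_coeff f k * z powi k))
            \<le> M - (\<Sum>k\<in>A. norm (circle_coeff f k) * \<rho> ^ nat \<bar>k\<bar>)"
          by (rule Laurent_tail_bound[OF _ _ _ A(1) sum[OF z] M])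
        then show ?thesis
          using Y(2)[OF A] by (simp add: dist_norm norm_minus_commute)
      qed
      then show "\<forall>\<^sub>F A in finite_subsets_at_top UNIV. \<forall>z\<in>annulus \<rho>.
          dist (\<Sum>k\<in>A. circle_coeff f k * z powi k) (F z) < e"
        unfolding eventually_finite_subsets_at_top using Y(1)
        by (intro exI[of _ Y] conjI allI impI ballI) auto
    qed
    have "F holomorphic_on annulus \<rho>"
      unfolding holomorphic_on_open[OF open_annulus]
    proof
      fix z assume "z \<in> annulus \<rho>"
      then obtain d where d: "d > 0" "cball z d \<subseteq> annulus \<rho>"
        using open_annulus open_contains_cball by blast
      have "0 \<notin> annulus \<rho>"
        using annulus_nonzero[of \<rho> 0] \<rho> by auto
      then have nz: "cball z d \<subseteq> UNIV - {0}" "ball z d \<subseteq> UNIV - {0}"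
        using d(2) ball_subset_cball[of z d] by blast+
      have "\<forall>\<^sub>F A in finite_subsets_at_top UNIV.
          continuous_on (cball z d) (\<lambda>z. \<Sum>k\<in>A. circle_coeff f k * z powi k) \<and>
          (\<lambda>z. \<Sum>k\<in>A. circle_coeff f k * z powi k) holomorphic_on ball z d"
        using nz holomorphic_on_subset[OF Laurent_polynomial_holomorphic]
        by (intro always_eventually allI conjI holomorphic_on_imp_continuous_on) auto
      then have "F holomorphic_on ball z d"
        using uniform_limit_on_subset[OF unif d(2)]
        by (rule holomorphic_uniform_limit) auto
      then show "\<exists>f'. (F has_field_derivative f') (at z)"
        using d(1) holomorphic_on_open[OF open_ball] by auto
    qed
    then show ?thesis using sum by blast
  qed
  have "F holomorphic_on UNIV - {0}"
    unfolding holomorphic_on_open[OF open_delete[OF open_UNIV]]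
  proof
    fix z :: complex assume "z \<in> UNIV - {0}"
    then have z: "z \<noteq> 0" by simp
    show "\<exists>f'. (F has_field_derivative f') (at z)"
      using hol[OF point_in_annulus(1)[OF z]] point_in_annulus(2)[OF z]
        holomorphic_on_open[OF open_annulus] by blast
  qed
  moreover have "f = on_circle F"
  proof -
    obtain l G where G: "1 < l" "G holomorphic_on annulus l" "f = on_circle G"
      using A1_circle_analytic[OF f] by (auto simp: analytic_circle_def bdd_holo_def)
    have "G z = F z" if "norm z = 1" for z
      using circle_Laurent_expansion[OF G(2,1), of z] hol[OF G(1)] unit_in_annulus[OF G(1) that]
        G(3) has_sum_unique by blast
    then show ?thesis
      by (simp add: G(3) on_circle_eq_iff)
  qed
  ultimately show ?thesis by blast
qed

lemma holo_ext:
  assumes "f \<in> A1_circle"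
  shows "holo_ext f holomorphic_on UNIV - {0}" "on_circle (holo_ext f) = f"
  using someI_ex[OF A1_circle_extension[OF assms]] unfolding holo_ext_def by auto

lemma holo_ext_has_sum:
  assumes "f \<in> A1_circle" "z \<noteq> 0"
  shows "((\<lambda>k. circle_coeff f k * z powi k) has_sum holo_ext f z) UNIV"
proof -
  have "holo_ext f holomorphic_on annulus (norm z + 1 / norm z + 1)"
    using holo_ext(1)[OF assms(1)] bdd_holo_punctured_plane by (auto simp: bdd_holo_def)
  from circle_Laurent_expansion[OF this point_in_annulus[OF assms(2)]] show ?thesis
    by (simp add: holo_ext(2)[OF assms(1)])
qed

text \<open>Two extensions have the same Fourier integrals on the circle, hence the same Laurent
  series at every nonzero point. This replaces the choice inside \<open>holo_ext\<close> by any
  convenient extension.\<close>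

lemma holo_ext_unique:
  assumes F: "F holomorphic_on UNIV - {0}" and f: "f \<in> A1_circle" "on_circle F = f" and "z \<noteq> 0"
  shows "holo_ext f z = F z"
proof -
  have "F holomorphic_on annulus (norm z + 1 / norm z + 1)"
    using F bdd_holo_punctured_plane by (auto simp: bdd_holo_def)
  from circle_Laurent_expansion[OF this point_in_annulus[OF \<open>z \<noteq> 0\<close>]] show ?thesis
    using holo_ext_has_sum[OF f(1) \<open>z \<noteq> 0\<close>] f(2) has_sum_unique by blast
qed

section \<open>Moderate and null sequences\<close>

lemma (in algebra) quotient_algebra:
  assumes "ideal I M"
  defines "Q \<equiv> ring.extend (M Quot I) (module.fields (\<lambda>a U. \<Union>x\<in>U. I +>\<^bsub>M\<^esub> (a \<odot>\<^bsub>M\<^esub> x)))"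
  shows "algebra R Q"
    and "\<And>a x. a \<in> carrier R \<Longrightarrow> x \<in> carrier M \<Longrightarrow> a \<odot>\<^bsub>Q\<^esub> (I +>\<^bsub>M\<^esub> x) = I +>\<^bsub>M\<^esub> (a \<odot>\<^bsub>M\<^esub> x)"
proof -
  interpret I: ideal I M by fact
  have fields: "carrier Q = a_rcosets\<^bsub>M\<^esub> I" "mult Q = rcoset_mult M I"
    "one Q = I +>\<^bsub>M\<^esub> \<one>\<^bsub>M\<^esub>" "zero Q = I" "add Q = set_add M"
    "smult Q = (\<lambda>a U. \<Union>x\<in>U. I +>\<^bsub>M\<^esub> (a \<odot>\<^bsub>M\<^esub> x))"
    by (simp_all add: Q_def ring.defs module.defs FactRing_def)
  \<comment> \<open>A ring ideal absorbs scalars, because multiplying by \<open>a\<close> is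
    multiplying by the ring element \<open>a\<close> times one.\<close>
  have smult_I: "a \<odot>\<^bsub>M\<^esub> x \<in> I" if "a \<in> carrier R" "x \<in> I" for a x
  proof -
    have x: "x \<in> carrier M" using that I.a_subset by auto
    have "a \<odot>\<^bsub>M\<^esub> x = (a \<odot>\<^bsub>M\<^esub> \<one>\<^bsub>M\<^esub>) \<otimes>\<^bsub>M\<^esub> x"
      using that x by (simp add: smult_assoc2)
    then show ?thesis
      using that I.I_l_closed by simp
  qed
  show sm: "a \<odot>\<^bsub>Q\<^esub> (I +>\<^bsub>M\<^esub> x) = I +>\<^bsub>M\<^esub> (a \<odot>\<^bsub>M\<^esub> x)"
    if "a \<in> carrier R" "x \<in> carrier M" for a x
  proof -
    \<comment> \<open>Members of one coset differ by an element of \<open>I\<close>, which scaling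
      keeps in \<open>I\<close>. All cosets in the defining union coincide, and the union is
      nonempty because it includes the one of \<open>x\<close>.\<close>
    have "I +>\<^bsub>M\<^esub> (a \<odot>\<^bsub>M\<^esub> y) = I +>\<^bsub>M\<^esub> (a \<odot>\<^bsub>M\<^esub> x)" if y: "y \<in> I +>\<^bsub>M\<^esub> x" for y
    proof -
      obtain h where h: "h \<in> I" "y = h \<oplus>\<^bsub>M\<^esub> x"
        using y by (auto simp: a_r_coset_def')
      have hM: "h \<in> carrier M" using h I.a_subset by auto
      have "a \<odot>\<^bsub>M\<^esub> y = (a \<odot>\<^bsub>M\<^esub> h) \<oplus>\<^bsub>M\<^esub> (a \<odot>\<^bsub>M\<^esub> x)"
        using h hM that \<open>a \<in> carrier R\<close> \<open>x \<in> carrier M\<close> by (simp add: smult_r_distr)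
      then have "a \<odot>\<^bsub>M\<^esub> y \<in> I +>\<^bsub>M\<^esub> (a \<odot>\<^bsub>M\<^esub> x)"
        using smult_I[OF \<open>a \<in> carrier R\<close> h(1)] by (auto simp: a_r_coset_def')
      then show ?thesis
        using M.a_repr_independence[OF _ _ I.a_subgroup] \<open>a \<in> carrier R\<close> \<open>x \<in> carrier M\<close>
        by (metis smult_closed)
    qed
    moreover have "x \<in> I +>\<^bsub>M\<^esub> x"
      using I.a_rcos_self that by blast
    ultimately show ?thesis
      unfolding fields by blast
  qed
  have cosetE: "\<exists>x\<in>carrier M. U = I +>\<^bsub>M\<^esub> x" if "U \<in> carrier Q" for U
    using that by (auto simp: fields A_RCOSETS_def')
  have cosetI: "I +>\<^bsub>M\<^esub> x \<in> carrier Q" if "x \<in> carrier M" for x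
    using that by (auto simp: fields A_RCOSETS_def')
  have add: "(I +>\<^bsub>M\<^esub> x) \<oplus>\<^bsub>Q\<^esub> (I +>\<^bsub>M\<^esub> y) = I +>\<^bsub>M\<^esub> (x \<oplus>\<^bsub>M\<^esub> y)"
    if "x \<in> carrier M" "y \<in> carrier M" for x y
    unfolding fields using I.a_rcos_sum that by simp
  have mult: "(I +>\<^bsub>M\<^esub> x) \<otimes>\<^bsub>Q\<^esub> (I +>\<^bsub>M\<^esub> y) = I +>\<^bsub>M\<^esub> (x \<otimes>\<^bsub>M\<^esub> y)"
    if "x \<in> carrier M" "y \<in> carrier M" for x y
    unfolding fields using I.rcoset_mult_add that by simp
  \<comment> \<open>\<open>Q\<close> is the quotient ring with a scalar multiplication appended to
    the record, so the ring axioms are transferred operation by operation.\<close>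
  have cring_Q: "cring Q"
  proof -
    interpret F: cring "M Quot I"
      by (rule I.quotient_is_cring[OF M_cring])
    have eq: "carrier Q = carrier (M Quot I)" "mult Q = mult (M Quot I)" "one Q = one (M Quot I)"
      "zero Q = zero (M Quot I)" "add Q = add (M Quot I)"
      by (simp_all add: fields FactRing_def)
    show ?thesis
    proof (rule cringI)
      show "abelian_group Q"
        by (rule abelian_groupI)
           (unfold eq, auto simp: F.a_ac intro: F.l_neg F.a_inv_closed)
      show "comm_monoid Q"
        by (rule comm_monoidI) (unfold eq, auto simp: F.m_ac)
    qed (unfold eq, simp add: F.l_distr)
  qed
  show "algebra R Q"
  proof (rule algebraI[OF R_cring cring_Q])
    fix a x assume "a \<in> carrier R" "x \<in> carrier Q"
    then show "a \<odot>\<^bsub>Q\<^esub> x \<in> carrier Q"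
      by (auto dest!: cosetE intro!: cosetI simp: sm)
  next
    fix a b x assume "a \<in> carrier R" "b \<in> carrier R" "x \<in> carrier Q"
    then show "(a \<oplus> b) \<odot>\<^bsub>Q\<^esub> x = a \<odot>\<^bsub>Q\<^esub> x \<oplus>\<^bsub>Q\<^esub> b \<odot>\<^bsub>Q\<^esub> x"
      "(a \<otimes> b) \<odot>\<^bsub>Q\<^esub> x = a \<odot>\<^bsub>Q\<^esub> (b \<odot>\<^bsub>Q\<^esub> x)"
      by (auto dest!: cosetE simp: sm add smult_l_distr smult_assoc1)
  next
    fix a x y assume "a \<in> carrier R" "x \<in> carrier Q" "y \<in> carrier Q"
    then show "a \<odot>\<^bsub>Q\<^esub> (x \<oplus>\<^bsub>Q\<^esub> y) = a \<odot>\<^bsub>Q\<^esub> x \<oplus>\<^bsub>Q\<^esub> a \<odot>\<^bsub>Q\<^esub> y"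
      "(a \<odot>\<^bsub>Q\<^esub> x) \<otimes>\<^bsub>Q\<^esub> y = a \<odot>\<^bsub>Q\<^esub> (x \<otimes>\<^bsub>Q\<^esub> y)"
      by (auto dest!: cosetE simp: sm add mult smult_r_distr smult_assoc2)
  next
    fix x assume "x \<in> carrier Q"
    then show "\<one> \<odot>\<^bsub>Q\<^esub> x = x"
      by (auto dest!: cosetE simp: sm)
  qed
qed

lemma complex_ring_fields [simp]:
  "carrier complex_ring = UNIV" "add complex_ring = (+)" "mult complex_ring = (*)"
  "one complex_ring = 1" "zero complex_ring = 0"
  by (auto simp: ring_of_type_algebra_def)

lemma complex_ring_cring: "cring complex_ring"
  by (rule cring_from_type_algebra)

lemma A1_alg_fields [simp]:
  "carrier A1_alg = A1_circle" "mult A1_alg = (\<lambda>f g z. f z * g z)" "one A1_alg = (\<lambda>z. 1)"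
  "zero A1_alg = (\<lambda>z. 0)" "add A1_alg = (\<lambda>f g z. f z + g z)" "smult A1_alg = (\<lambda>a f z. a * f z)"
  by (simp_all add: A1_alg_def)

lemma X_alg_fields [simp]:
  "carrier (X_alg r) = Xset r" "mult (X_alg r) = (\<lambda>f g n z. f n z * g n z)" "one (X_alg r) = (\<lambda>n z. 1)"
  "zero (X_alg r) = (\<lambda>n z. 0)" "add (X_alg r) = (\<lambda>f g n z. f n z + g n z)"
  "smult (X_alg r) = (\<lambda>a f n z. a * f n z)"
  by (simp_all add: X_alg_def)

lemma A1_circle_uminus: "f \<in> A1_circle \<Longrightarrow> (\<lambda>z. - f z) \<in> A1_circle"
  using A1_circle_cmult[of f "- 1"] by simp

lemma algebra_A1_alg: "Module.algebra complex_ring A1_alg"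
proof (rule algebraI[OF complex_ring_cring])
  show "cring A1_alg"
  proof (rule cringI)
    show "abelian_group A1_alg"
    proof (rule abelian_groupI)
      fix f assume "f \<in> carrier A1_alg"
      then show "\<exists>g\<in>carrier A1_alg. g \<oplus>\<^bsub>A1_alg\<^esub> f = \<zero>\<^bsub>A1_alg\<^esub>"
        by (intro bexI[of _ "\<lambda>z. - f z"]) (auto intro: A1_circle_uminus)
    qed (auto simp: A1_circle_add A1_circle_const algebra_simps)
    show "comm_monoid A1_alg"
      by (rule comm_monoidI) (auto simp: A1_circle_mult A1_circle_const algebra_simps)
  qed (auto simp: algebra_simps)
qed (auto simp: A1_circle_cmult algebra_simps)

section \<open>Supremum norms of the extensions\<close>

abbreviation qext :: "real \<Rightarrow> (circle \<Rightarrow> complex) \<Rightarrow> real" where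
  "qext l f \<equiv> qnorm l (holo_ext f)"

lemma holo_ext_bdd_holo: "f \<in> A1_circle \<Longrightarrow> holo_ext f \<in> bdd_holo l"
  by (intro bdd_holo_punctured_plane holo_ext(1))

lemma qext_nonneg: "1 < l \<Longrightarrow> f \<in> A1_circle \<Longrightarrow> 0 \<le> qext l f"
  by (intro qnorm_nonneg holo_ext_bdd_holo)

lemma qext_upper: "f \<in> A1_circle \<Longrightarrow> z \<in> annulus l \<Longrightarrow> norm (holo_ext f z) \<le> qext l f"
  by (intro qnorm_upper holo_ext_bdd_holo)

lemma norm_le_qext:
  assumes "1 < l" "f \<in> A1_circle"
  shows "norm (f z) \<le> qext l f"
proof -
  have "f z = holo_ext f (point_of z)"
    using holo_ext(2)[OF assms(2)] unfolding on_circle_def by metis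
  then show ?thesis
    using assms by (simp add: qext_upper unit_in_annulus)
qed

lemma qext_mono:
  assumes "1 < l" "l \<le> l'" "f \<in> A1_circle"
  shows "qext l f \<le> qext l' f"
  using assms annulus_mono[of l l'] by (intro qnorm_least) (auto intro!: qext_upper)

text \<open>Being a choice, \<open>holo_ext\<close> is additive only through uniqueness, hence only
  away from 0.\<close>

lemma holo_ext_add:
  assumes "f \<in> A1_circle" "g \<in> A1_circle" "z \<noteq> 0"
  shows "holo_ext (\<lambda>w. f w + g w) z = holo_ext f z + holo_ext g z"
  using assms holo_ext[OF assms(1)] holo_ext[OF assms(2)]
  by (intro holo_ext_unique holomorphic_on_add A1_circle_add) (auto simp: on_circle_def fun_eq_iff)

lemma holo_ext_mult:
  assumes "f \<in> A1_circle" "g \<in> A1_circle" "z \<noteq> 0"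
  shows "holo_ext (\<lambda>w. f w * g w) z = holo_ext f z * holo_ext g z"
  using assms holo_ext[OF assms(1)] holo_ext[OF assms(2)]
  by (intro holo_ext_unique holomorphic_on_mult A1_circle_mult) (auto simp: on_circle_def fun_eq_iff)

lemma holo_ext_const: "z \<noteq> 0 \<Longrightarrow> holo_ext (\<lambda>w. a) z = a"
  using holo_ext_unique[of "\<lambda>w. a" "\<lambda>w. a" z] by (simp add: A1_circle_const on_circle_def)

lemma qext_add:
  assumes "1 < l" "f \<in> A1_circle" "g \<in> A1_circle"
  shows "qext l (\<lambda>z. f z + g z) \<le> qext l f + qext l g"
proof (rule qnorm_least[OF assms(1)])
  fix z assume z: "z \<in> annulus l"
  then have "z \<noteq> 0" using assms(1) annulus_nonzero[of l] by auto
  then show "norm (holo_ext (\<lambda>z. f z + g z) z) \<le> qext l f + qext l g"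
    using assms z by (simp add: holo_ext_add norm_triangle_mono qext_upper)
qed

lemma qext_mult:
  assumes "1 < l" "f \<in> A1_circle" "g \<in> A1_circle"
  shows "qext l (\<lambda>z. f z * g z) \<le> qext l f * qext l g"
proof (rule qnorm_least[OF assms(1)])
  fix z assume z: "z \<in> annulus l"
  then have "z \<noteq> 0" using assms(1) annulus_nonzero[of l] by auto
  then show "norm (holo_ext (\<lambda>z. f z * g z) z) \<le> qext l f * qext l g"
    using assms z by (simp add: holo_ext_mult norm_mult mult_mono qext_upper qext_nonneg)
qed

lemma qext_const_le: "1 < l \<Longrightarrow> qext l (\<lambda>z. a) \<le> norm a"
  using annulus_nonzero[of l] by (intro qnorm_least) (auto simp: holo_ext_const)

section \<open>Growth measured on the scale \<open>1 / r n\<close>\<close>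

locale gauge =
  fixes r :: "nat \<Rightarrow> real"
  assumes r_pos: "\<And>n. r n > 0" and r_lim: "r \<longlonglongrightarrow> 0"
begin

lemma inverse_r_at_top: "filterlim (\<lambda>n. 1 / r n) at_top sequentially"
  using filterlim_inverse_at_top[OF r_lim] r_pos by (simp add: inverse_eq_divide)

lemma eventually_inverse_r_ge: "eventually (\<lambda>n. c \<le> 1 / r n) sequentially"
  using inverse_r_at_top unfolding filterlim_at_top by blast

text \<open>Removes the root from the growth conditions. The case \<open>q = 0\<close> is included,
  since \<open>0 powr x = 0\<close>.\<close>

lemma powr_le_iff:
  assumes "0 \<le> q" "0 < B"
  shows "q powr r n \<le> B \<longleftrightarrow> q \<le> B powr (1 / r n)"
proof
  assume "q powr r n \<le> B"
  then have "(q powr r n) powr (1 / r n) \<le> B powr (1 / r n)"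
    using r_pos[of n] by (intro powr_mono2) auto
  then show "q \<le> B powr (1 / r n)"
    using r_pos[of n] assms by (simp add: powr_powr)
next
  assume "q \<le> B powr (1 / r n)"
  then have "q powr r n \<le> (B powr (1 / r n)) powr r n"
    using r_pos[of n] assms by (intro powr_mono2) auto
  then show "q powr r n \<le> B"
    using r_pos[of n] assms by (simp add: powr_powr)
qed

text \<open>As eventual bounds, the conditions for two sequences can be combined by arithmetic on
  the bases.\<close>

lemma Xset_iff:
  "f \<in> Xset r \<longleftrightarrow> (\<forall>n. f n \<in> A1_circle) \<and>
    (\<exists>l>1. \<exists>B>0. \<forall>\<^sub>F n in sequentially. qext l (f n) \<le> B powr (1 / r n))"
proof -
  have "limsup (\<lambda>n. ereal (qext l (f n) powr r n)) < \<infinity> \<longleftrightarrow>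
      (\<exists>B>0. \<forall>\<^sub>F n in sequentially. qext l (f n) \<le> B powr (1 / r n))"
    if f: "\<And>n. f n \<in> A1_circle" and l: "1 < l" for l
  proof
    assume "limsup (\<lambda>n. ereal (qext l (f n) powr r n)) < \<infinity>"
    then obtain N :: nat where "limsup (\<lambda>n. ereal (qext l (f n) powr r n)) < ereal (real N)"
      using less_PInf_Ex_of_nat by auto
    from Limsup_lessD[OF this]
    \<comment> \<open>The base must be positive to apply \<open>powr_le_iff\<close>, and
      \<open>N\<close> itself might be 0.\<close>
    have "\<forall>\<^sub>F n in sequentially. qext l (f n) powr r n \<le> real N + 1"
      by eventually_elim simp
    then have "\<forall>\<^sub>F n in sequentially. qext l (f n) \<le> (real N + 1) powr (1 / r n)"
      by eventually_elim (simp add: powr_le_iff qext_nonneg f l add_nonneg_pos)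
    then show "\<exists>B>0. \<forall>\<^sub>F n in sequentially. qext l (f n) \<le> B powr (1 / r n)"
      by (intro exI[of _ "real N + 1"]) simp
  next
    assume "\<exists>B>0. \<forall>\<^sub>F n in sequentially. qext l (f n) \<le> B powr (1 / r n)"
    then obtain B where B: "B > 0" "\<forall>\<^sub>F n in sequentially. qext l (f n) \<le> B powr (1 / r n)" by blast
    from B(2) have "\<forall>\<^sub>F n in sequentially. ereal (qext l (f n) powr r n) \<le> ereal B"
      by eventually_elim (simp add: powr_le_iff qext_nonneg f l B(1))
    then have "limsup (\<lambda>n. ereal (qext l (f n) powr r n)) \<le> ereal B"
      by (rule Limsup_bounded)
    then show "limsup (\<lambda>n. ereal (qext l (f n) powr r n)) < \<infinity>"
      by (rule le_less_trans) simp
  qed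
  then show ?thesis
    unfolding Xset_def by auto
qed

text \<open>The terms are nonnegative, so a vanishing limsup is convergence to 0. The radius
  \<open>l\<close> is fixed before \<open>e\<close>.\<close>

lemma Nset_iff:
  "f \<in> Nset r \<longleftrightarrow> (\<forall>n. f n \<in> A1_circle) \<and>
    (\<exists>l>1. \<forall>e>0. \<forall>\<^sub>F n in sequentially. qext l (f n) \<le> e powr (1 / r n))"
proof -
  have "limsup (\<lambda>n. ereal (qext l (f n) powr r n)) = 0 \<longleftrightarrow>
      (\<forall>e>0. \<forall>\<^sub>F n in sequentially. qext l (f n) \<le> e powr (1 / r n))"
    if f: "\<And>n. f n \<in> A1_circle" and l: "1 < l" for l
  proof
    assume *: "limsup (\<lambda>n. ereal (qext l (f n) powr r n)) = 0"
    show "\<forall>e>0. \<forall>\<^sub>F n in sequentially. qext l (f n) \<le> e powr (1 / r n)"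
    proof (intro allI impI)
      fix e :: real assume e: "e > 0"
      then have "limsup (\<lambda>n. ereal (qext l (f n) powr r n)) < ereal e"
        using * by simp
      from Limsup_lessD[OF this]
      show "\<forall>\<^sub>F n in sequentially. qext l (f n) \<le> e powr (1 / r n)"
        by eventually_elim (simp add: e qext_nonneg f l flip: powr_le_iff)
    qed
  next
    assume *: "\<forall>e>0. \<forall>\<^sub>F n in sequentially. qext l (f n) \<le> e powr (1 / r n)"
    have "(\<lambda>n. qext l (f n) powr r n) \<longlonglongrightarrow> 0"
    proof (rule tendstoI)
      fix e :: real assume e: "e > 0"
      \<comment> \<open>Halving \<open>e\<close> provides the strict inequality that the limit asks
        for.\<close>
      have "\<forall>\<^sub>F n in sequentially. qext l (f n) \<le> (e / 2) powr (1 / r n)"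
        using * e half_gt_zero by blast
      then show "\<forall>\<^sub>F n in sequentially. dist (qext l (f n) powr r n) 0 < e"
      proof eventually_elim
        case (elim n)
        then have "qext l (f n) powr r n \<le> e / 2"
          using e f l by (subst powr_le_iff) (auto simp: qext_nonneg)
        then show ?case using e by simp
      qed
    qed
    then have "(\<lambda>n. ereal (qext l (f n) powr r n)) \<longlonglongrightarrow> ereal 0"
      by (rule tendsto_ereal)
    then show "limsup (\<lambda>n. ereal (qext l (f n) powr r n)) = 0"
      by (simp only: lim_imp_Limsup[OF sequentially_bot] zero_ereal_def)
  qed
  then show ?thesis
    unfolding Nset_def by auto
qed

lemma XsetI:
  assumes "\<And>n. f n \<in> A1_circle" "1 < l" "0 < B"
    "\<forall>\<^sub>F n in sequentially. qext l (f n) \<le> B powr (1 / r n)"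
  shows "f \<in> Xset r"
  using assms unfolding Xset_iff by blast

lemma NsetI:
  assumes "\<And>n. f n \<in> A1_circle" "1 < l"
    "\<And>e. 0 < e \<Longrightarrow> \<forall>\<^sub>F n in sequentially. qext l (f n) \<le> e powr (1 / r n)"
  shows "f \<in> Nset r"
  using assms unfolding Nset_iff by blast

lemma Nset_subset_Xset: "Nset r \<subseteq> Xset r"
proof
  fix f assume "f \<in> Nset r"
  then obtain l where "1 < l" "\<And>n. f n \<in> A1_circle"
    "\<forall>e>0. \<forall>\<^sub>F n in sequentially. qext l (f n) \<le> e powr (1 / r n)"
    unfolding Nset_iff by blast
  then show "f \<in> Xset r"
    by (intro XsetI[of f l 1]) (auto dest: spec[of _ "1::real"])
qed

text \<open>A base of at least 1 only grows under an exponent of at least 1, so constants can be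
  absorbed into the base for large \<open>n\<close>.\<close>

lemma constant_le_powr:
  assumes "1 \<le> 1 / r n" "0 \<le> c"
  shows "c \<le> (c + 1) powr (1 / r n)"
  using powr_mono[OF assms(1), of "c + 1"] assms(2) by simp

lemma Xset_const:
  assumes "f \<in> A1_circle"
  shows "(\<lambda>n. f) \<in> Xset r"
proof (rule XsetI[of _ 2 "qext 2 f + 1"])
  show "\<forall>\<^sub>F n in sequentially. qext 2 f \<le> (qext 2 f + 1) powr (1 / r n)"
    using eventually_inverse_r_ge[of 1]
    by eventually_elim (simp add: constant_le_powr qext_nonneg assms)
qed (use assms qext_nonneg[of 2 f] in auto)

text \<open>Shrinking the annulus lowers the suprema and enlarging the base raises the bounds, so
  the smaller radius and the larger base work for both.\<close>

lemma Xset_pair: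
  assumes "f \<in> Xset r" "g \<in> Xset r"
  obtains l B where "1 < l" "0 < B" "\<forall>\<^sub>F n in sequentially. qext l (f n) \<le> B powr (1 / r n)"
    "\<forall>\<^sub>F n in sequentially. qext l (g n) \<le> B powr (1 / r n)"
proof -
  obtain l1 B1 where 1: "1 < l1" "0 < B1" "\<And>n. f n \<in> A1_circle"
    "\<forall>\<^sub>F n in sequentially. qext l1 (f n) \<le> B1 powr (1 / r n)"
    using assms(1) unfolding Xset_iff by auto
  obtain l2 B2 where 2: "1 < l2" "0 < B2" "\<And>n. g n \<in> A1_circle"
    "\<forall>\<^sub>F n in sequentially. qext l2 (g n) \<le> B2 powr (1 / r n)"
    using assms(2) unfolding Xset_iff by auto
  let ?l = "min l1 l2" and ?B = "max B1 B2"
  have "B1 powr (1 / r n) \<le> ?B powr (1 / r n)" "B2 powr (1 / r n) \<le> ?B powr (1 / r n)" for n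
    using 1(2) 2(2) r_pos[of n] by (auto intro!: powr_mono2)
  moreover have "qext ?l (f n) \<le> qext l1 (f n)" "qext ?l (g n) \<le> qext l2 (g n)" for n
    using 1 2 by (auto intro!: qext_mono)
  ultimately have le: "qext l1 (f n) \<le> B1 powr (1 / r n) \<Longrightarrow> qext ?l (f n) \<le> ?B powr (1 / r n)"
    "qext l2 (g n) \<le> B2 powr (1 / r n) \<Longrightarrow> qext ?l (g n) \<le> ?B powr (1 / r n)" for n
    by (meson order_trans)+
  have "\<forall>\<^sub>F n in sequentially. qext ?l (f n) \<le> ?B powr (1 / r n)"
    using 1(4) by (rule eventually_mono) (rule le(1))
  moreover have "\<forall>\<^sub>F n in sequentially. qext ?l (g n) \<le> ?B powr (1 / r n)"
    using 2(4) by (rule eventually_mono) (rule le(2))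
  ultimately show ?thesis
    using that[of ?l ?B] 1 2 by auto
qed

text \<open>The factor 2 is at most \<open>2 powr (1 / r n)\<close> and so moves into the
  base.\<close>

lemma powr_add_self_le:
  assumes "1 \<le> 1 / r n" "0 < B"
  shows "B powr (1 / r n) + B powr (1 / r n) \<le> (2 * B) powr (1 / r n)"
proof -
  have "2 \<le> (2::real) powr (1 / r n)"
    using powr_mono[OF assms(1), of 2] by simp
  then show ?thesis
    using mult_right_mono[of 2 "2 powr (1 / r n)" "B powr (1 / r n)"] assms(2)
    by (simp add: powr_mult)
qed

lemma Xset_add:
  assumes "f \<in> Xset r" "g \<in> Xset r"
  shows "(\<lambda>n z. f n z + g n z) \<in> Xset r"
proof -
  obtain l B where lB: "1 < l" "0 < B" "\<forall>\<^sub>F n in sequentially. qext l (f n) \<le> B powr (1 / r n)"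
    "\<forall>\<^sub>F n in sequentially. qext l (g n) \<le> B powr (1 / r n)"
    using assms by (rule Xset_pair)
  have A: "\<And>n. f n \<in> A1_circle" "\<And>n. g n \<in> A1_circle"
    using assms by (auto simp: Xset_iff)
  show ?thesis
  proof (rule XsetI[of _ l "2 * B"])
    show "\<forall>\<^sub>F n in sequentially. qext l (\<lambda>z. f n z + g n z) \<le> (2 * B) powr (1 / r n)"
      using lB(3,4) eventually_inverse_r_ge[of 1]
    proof eventually_elim
      case (elim n)
      then show ?case
        using qext_add[OF lB(1) A(1)[of n] A(2)[of n]] powr_add_self_le[of n B] lB(2) by linarith
    qed
  qed (use lB A in \<open>auto intro: A1_circle_add\<close>)
qed

lemma Xset_mult:
  assumes "f \<in> Xset r" "g \<in> Xset r"
  shows "(\<lambda>n z. f n z * g n z) \<in> Xset r"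
proof -
  obtain l B where lB: "1 < l" "0 < B" "\<forall>\<^sub>F n in sequentially. qext l (f n) \<le> B powr (1 / r n)"
    "\<forall>\<^sub>F n in sequentially. qext l (g n) \<le> B powr (1 / r n)"
    using assms by (rule Xset_pair)
  have A: "\<And>n. f n \<in> A1_circle" "\<And>n. g n \<in> A1_circle"
    using assms by (auto simp: Xset_iff)
  show ?thesis
  proof (rule XsetI[of _ l "B * B"])
    show "\<forall>\<^sub>F n in sequentially. qext l (\<lambda>z. f n z * g n z) \<le> (B * B) powr (1 / r n)"
      using lB(3,4)
    proof eventually_elim
      case (elim n)
      then have "qext l (f n) * qext l (g n) \<le> B powr (1 / r n) * B powr (1 / r n)"
        using A lB by (intro mult_mono) (auto simp: qext_nonneg)
      then show ?case
        using qext_mult[OF lB(1) A(1)[of n] A(2)[of n]] lB(2) by (simp add: powr_mult)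
    qed
  qed (use lB A in \<open>auto intro: A1_circle_mult\<close>)
qed

lemma Xset_cmult: "f \<in> Xset r \<Longrightarrow> (\<lambda>n z. a * f n z) \<in> Xset r"
  using Xset_mult[OF Xset_const[OF A1_circle_const]] .

lemma Nset_add:
  assumes "f \<in> Nset r" "g \<in> Nset r"
  shows "(\<lambda>n z. f n z + g n z) \<in> Nset r"
proof -
  obtain l1 where 1: "1 < l1" "\<And>n. f n \<in> A1_circle"
    "\<And>e. e > 0 \<Longrightarrow> \<forall>\<^sub>F n in sequentially. qext l1 (f n) \<le> e powr (1 / r n)"
    using assms(1) unfolding Nset_iff by auto
  obtain l2 where 2: "1 < l2" "\<And>n. g n \<in> A1_circle"
    "\<And>e. e > 0 \<Longrightarrow> \<forall>\<^sub>F n in sequentially. qext l2 (g n) \<le> e powr (1 / r n)"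
    using assms(2) unfolding Nset_iff by auto
  let ?l = "min l1 l2"
  have l: "1 < ?l" using 1 2 by simp
  show ?thesis
  proof (rule NsetI[OF _ l])
    fix e :: real assume e: "e > 0"
    show "\<forall>\<^sub>F n in sequentially. qext ?l (\<lambda>z. f n z + g n z) \<le> e powr (1 / r n)"
      using 1(3)[OF half_gt_zero[OF e]] 2(3)[OF half_gt_zero[OF e]] eventually_inverse_r_ge[of 1]
    proof eventually_elim
      case (elim n)
      have "qext ?l (f n) \<le> qext l1 (f n)" "qext ?l (g n) \<le> qext l2 (g n)"
        using 1 2 by (auto intro!: qext_mono)
      then show ?case
        using elim qext_add[OF l 1(2)[of n] 2(2)[of n]] powr_add_self_le[of n "e / 2"] e by simp
    qed
  qed (use 1 2 in \<open>auto intro: A1_circle_add\<close>)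
qed

lemma Nset_mult:
  assumes "f \<in> Xset r" "g \<in> Nset r"
  shows "(\<lambda>n z. f n z * g n z) \<in> Nset r"
proof -
  obtain l1 B where 1: "1 < l1" "0 < B" "\<And>n. f n \<in> A1_circle"
    "\<forall>\<^sub>F n in sequentially. qext l1 (f n) \<le> B powr (1 / r n)"
    using assms(1) unfolding Xset_iff by auto
  obtain l2 where 2: "1 < l2" "\<And>n. g n \<in> A1_circle"
    "\<And>e. e > 0 \<Longrightarrow> \<forall>\<^sub>F n in sequentially. qext l2 (g n) \<le> e powr (1 / r n)"
    using assms(2) unfolding Nset_iff by auto
  let ?l = "min l1 l2"
  have l: "1 < ?l" using 1 2 by simp
  show ?thesis
  proof (rule NsetI[OF _ l])
    fix e :: real assume e: "e > 0"
    show "\<forall>\<^sub>F n in sequentially. qext ?l (\<lambda>z. f n z * g n z) \<le> e powr (1 / r n)"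
      \<comment> \<open>The null factor is used with \<open>e / B\<close>, whose power cancels the
        moderate growth of the other factor.\<close>
      using 1(4) 2(3)[OF divide_pos_pos[OF e 1(2)]]
    proof eventually_elim
      case (elim n)
      have "qext ?l (f n) \<le> B powr (1 / r n)" "qext ?l (g n) \<le> (e / B) powr (1 / r n)"
        using 1 2 elim qext_mono[of ?l l1 "f n"] qext_mono[of ?l l2 "g n"] by auto
      then have "qext ?l (f n) * qext ?l (g n) \<le> B powr (1 / r n) * (e / B) powr (1 / r n)"
        using 1 2 by (intro mult_mono) (auto simp: qext_nonneg)
      also have "\<dots> = e powr (1 / r n)"
        using e 1(2) by (simp flip: powr_mult)
      finally show ?case
        using qext_mult[OF l 1(3)[of n] 2(2)[of n]] by linarith
    qed
  qed (use 1 2 in \<open>auto intro: A1_circle_mult\<close>)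
qed

lemma Nset_cmult: "f \<in> Nset r \<Longrightarrow> (\<lambda>n z. a * f n z) \<in> Nset r"
  using Nset_mult[OF Xset_const[OF A1_circle_const]] .

lemma Nset_zero: "(\<lambda>n z. 0) \<in> Nset r"
proof (rule NsetI[of _ 2])
  show "\<forall>\<^sub>F n in sequentially. qext 2 (\<lambda>z. 0) \<le> e powr (1 / r n)" for e
    using qext_const_le[of 2 0] by (auto intro!: always_eventually intro: order_trans)
qed (auto intro: A1_circle_const)

lemma cring_X_alg: "cring (X_alg r)"
proof (rule cringI)
  show "abelian_group (X_alg r)"
  proof (rule abelian_groupI)
    fix f assume "f \<in> carrier (X_alg r)"
    then show "\<exists>g\<in>carrier (X_alg r). g \<oplus>\<^bsub>X_alg r\<^esub> f = \<zero>\<^bsub>X_alg r\<^esub>"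
      using Xset_cmult[of f "- 1"] by (intro bexI[of _ "\<lambda>n z. - f n z"]) auto
  qed (auto simp: Xset_add Xset_const A1_circle_const algebra_simps)
  show "comm_monoid (X_alg r)"
    by (rule comm_monoidI) (auto simp: Xset_mult Xset_const A1_circle_const algebra_simps)
qed (auto simp: algebra_simps)

lemma algebra_X_alg: "Module.algebra complex_ring (X_alg r)"
  by (rule algebraI[OF complex_ring_cring cring_X_alg]) (auto simp: Xset_cmult algebra_simps)

lemma ideal_Nset: "ideal (Nset r) (X_alg r)"
proof -
  interpret X: cring "X_alg r" by (rule cring_X_alg)
  show ?thesis
  proof (rule idealI)
    show "ring (X_alg r)" by (rule X.ring_axioms)
    show "subgroup (Nset r) (add_monoid (X_alg r))"
    proof (rule group.subgroupI[OF X.a_group])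
      show "Nset r \<subseteq> carrier (add_monoid (X_alg r))"
        using Nset_subset_Xset by simp
      show "Nset r \<noteq> {}"
        using Nset_zero by auto
      show "inv\<^bsub>add_monoid (X_alg r)\<^esub> f \<in> Nset r" if f: "f \<in> Nset r" for f
      proof -
        have "\<ominus>\<^bsub>X_alg r\<^esub> f = (\<lambda>n z. - 1 * f n z)"
        proof (rule X.minus_equality)
          show "f \<in> carrier (X_alg r)" "(\<lambda>n z. - 1 * f n z) \<in> carrier (X_alg r)"
            using f Nset_subset_Xset Nset_cmult[OF f, of "- 1"] by auto
        qed auto
        then show ?thesis
          using Nset_cmult[OF f, of "- 1"] by (simp add: a_inv_def)
      qed
    qed (auto intro: Nset_add)
  next
    fix a x assume "a \<in> Nset r" "x \<in> carrier (X_alg r)"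
    then have "(\<lambda>n z. x n z * a n z) \<in> Nset r"
      by (intro Nset_mult) auto
    then show "x \<otimes>\<^bsub>X_alg r\<^esub> a \<in> Nset r" "a \<otimes>\<^bsub>X_alg r\<^esub> x \<in> Nset r"
      by (simp_all add: mult.commute)
  qed
qed

lemma algebra_G_alg: "Module.algebra complex_ring (G_alg r)"
  unfolding G_alg_def by (rule algebra.quotient_algebra(1)[OF algebra_X_alg ideal_Nset])

lemma smult_cls: "f \<in> Xset r \<Longrightarrow> a \<odot>\<^bsub>G_alg r\<^esub> cls r f = cls r (\<lambda>n z. a * f n z)"
  using algebra.quotient_algebra(2)[OF algebra_X_alg ideal_Nset, of a f]
  by (simp add: G_alg_def cls_def)

lemma cls_ring_hom: "cls r \<in> ring_hom (X_alg r) (G_alg r)"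
proof -
  have "(+>\<^bsub>X_alg r\<^esub>) (Nset r) \<in> ring_hom (X_alg r) (X_alg r Quot Nset r)"
    by (rule ideal.rcos_ring_hom[OF ideal_Nset])
  then show ?thesis
    by (simp add: ring_hom_def cls_def [abs_def] G_alg_def ring.defs)
qed

lemma cls_eqI:
  assumes "g \<in> Xset r" "h \<in> Nset r" "\<And>n z. f n z = h n z + g n z"
  shows "cls r f = cls r g"
proof -
  interpret ideal "Nset r" "X_alg r" by (rule ideal_Nset)
  have "f = (\<lambda>n z. h n z + g n z)" using assms(3) by auto
  then have "f \<in> Nset r +>\<^bsub>X_alg r\<^esub> g"
    using assms(2) by (auto simp: a_r_coset_def')
  then show ?thesis
    using a_repr_independence[OF _ _ a_subgroup, of f g] assms(1) by (simp add: cls_def)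
qed

lemma cls_eqD:
  assumes "cls r f = cls r g" "f \<in> Xset r"
  obtains h where "h \<in> Nset r" "\<And>n z. f n z = h n z + g n z"
proof -
  interpret ideal "Nset r" "X_alg r" by (rule ideal_Nset)
  have "f \<in> Nset r +>\<^bsub>X_alg r\<^esub> g"
    using a_rcos_self[of f] assms unfolding cls_def by simp
  then show ?thesis
    using that by (auto simp: a_r_coset_def')
qed

end

section \<open>Embedding of the hyperfunctions\<close>

lemma hyperfun_space_fields [simp]:
  "carrier hyperfun_space = hyperfun" "zero hyperfun_space = (\<lambda>f\<in>analytic_circle. 0)"
  "add hyperfun_space = (\<lambda>H K. \<lambda>f\<in>analytic_circle. H f + K f)"
  "smult hyperfun_space = (\<lambda>a H. \<lambda>f\<in>analytic_circle. a * H f)"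
  by (simp_all add: hyperfun_space_def)

text \<open>Sums and multiples are both special cases, so continuity is checked once.\<close>

lemma hyperfun_combination:
  assumes "H \<in> hyperfun" "K \<in> hyperfun"
  shows "(\<lambda>f\<in>analytic_circle. a * H f + b * K f) \<in> hyperfun"
proof -
  let ?L = "\<lambda>f\<in>analytic_circle. a * H f + b * K f"
  have bound: "\<exists>C. \<forall>F\<in>bdd_holo l. norm (?L (on_circle F)) \<le> C * qnorm l F" if l: "1 < l" for l
  proof -
    obtain C D where C: "\<forall>F\<in>bdd_holo l. norm (H (on_circle F)) \<le> C * qnorm l F"
      and D: "\<forall>F\<in>bdd_holo l. norm (K (on_circle F)) \<le> D * qnorm l F"
      using assms l unfolding hyperfun_def by blast
    have "norm (?L (on_circle F)) \<le> (norm a * C + norm b * D) * qnorm l F" if F: "F \<in> bdd_holo l" for F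
    proof -
      have "on_circle F \<in> analytic_circle"
        using F l by (auto simp: analytic_circle_def)
      then have "norm (?L (on_circle F)) \<le> norm a * norm (H (on_circle F)) + norm b * norm (K (on_circle F))"
        using norm_triangle_ineq[of "a * H (on_circle F)" "b * K (on_circle F)"] by (simp add: norm_mult)
      also have "\<dots> \<le> norm a * (C * qnorm l F) + norm b * (D * qnorm l F)"
        using C D F by (intro add_mono mult_left_mono) auto
      finally show ?thesis by (simp add: algebra_simps)
    qed
    then show ?thesis by blast
  qed
  show ?thesis
    unfolding hyperfun_def
  proof (intro CollectI conjI ballI allI impI)
    fix f g assume "f \<in> analytic_circle" "g \<in> analytic_circle"
    moreover from this have "H (\<lambda>z. f z + g z) = H f + H g" "K (\<lambda>z. f z + g z) = K f + K g"
      using assms by (simp_all add: hyperfun_def)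
    ultimately show "?L (\<lambda>z. f z + g z) = ?L f + ?L g"
      by (simp add: analytic_circle_add algebra_simps)
  next
    fix c f assume "f \<in> analytic_circle"
    moreover from this have "H (\<lambda>z. c * f z) = c * H f" "K (\<lambda>z. c * f z) = c * K f"
      using assms by (simp_all add: hyperfun_def)
    ultimately show "?L (\<lambda>z. c * f z) = c * ?L f"
      by (simp add: analytic_circle_cmult algebra_simps)
  qed (use bound in auto)
qed

lemma hyperfun_add: "H \<in> hyperfun \<Longrightarrow> K \<in> hyperfun \<Longrightarrow> (\<lambda>f\<in>analytic_circle. H f + K f) \<in> hyperfun"
  using hyperfun_combination[of H K 1 1] by simp

lemma hyperfun_cmult: "H \<in> hyperfun \<Longrightarrow> (\<lambda>f\<in>analytic_circle. a * H f) \<in> hyperfun"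
  using hyperfun_combination[of H H a 0] by simp

lemma hyperfun_restrict: "H \<in> hyperfun \<Longrightarrow> restrict H analytic_circle = H"
  by (simp add: hyperfun_def extensional_restrict)

lemma hyperfun_zero: "(\<lambda>f\<in>analytic_circle. 0) \<in> hyperfun"
  using hyperfun_cmult[OF hyperfun_of_analytic(1)[OF analytic_circle_punctured_plane], of "\<lambda>z. 0" 0]
  by simp

lemma module_hyperfun_space: "Module.module complex_ring hyperfun_space"
proof (rule moduleI[OF complex_ring_cring])
  show "abelian_group hyperfun_space"
  proof (rule abelian_groupI)
    fix H assume H: "H \<in> carrier hyperfun_space"
    then show "\<zero>\<^bsub>hyperfun_space\<^esub> \<oplus>\<^bsub>hyperfun_space\<^esub> H = H"
      using hyperfun_restrict[of H] by (simp add: restrict_def cong: if_cong)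
    show "\<exists>K\<in>carrier hyperfun_space. K \<oplus>\<^bsub>hyperfun_space\<^esub> H = \<zero>\<^bsub>hyperfun_space\<^esub>"
      using H hyperfun_cmult[of H "- 1"]
      by (intro bexI[of _ "\<lambda>f\<in>analytic_circle. - 1 * H f"]) (auto intro!: restrict_ext)
  qed (auto simp: hyperfun_add hyperfun_zero add_ac intro!: restrict_ext)
next
  fix H assume "H \<in> carrier hyperfun_space"
  then show "\<one>\<^bsub>complex_ring\<^esub> \<odot>\<^bsub>hyperfun_space\<^esub> H = H"
    using hyperfun_restrict[of H] by simp
qed (auto simp: hyperfun_cmult algebra_simps intro!: restrict_ext)

lemma powi_on_circle_analytic: "on_circle (\<lambda>z. z powi k) \<in> analytic_circle"
  by (intro analytic_circle_punctured_plane powi_holomorphic_punctured)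

lemma finite_int_abs_le: "finite {k::int. \<bar>real_of_int k\<bar> \<le> x}"
proof (rule finite_subset)
  show "{k::int. \<bar>real_of_int k\<bar> \<le> x} \<subseteq> {- \<lfloor>x\<rfloor>..\<lfloor>x\<rfloor>}"
  proof
    fix k assume "k \<in> {k::int. \<bar>real_of_int k\<bar> \<le> x}"
    then have "k \<le> \<lfloor>x\<rfloor>" "- k \<le> \<lfloor>x\<rfloor>"
      by (auto simp: le_floor_iff)
    then show "k \<in> {- \<lfloor>x\<rfloor>..\<lfloor>x\<rfloor>}" by simp
  qed
qed simp

text \<open>Cauchy's estimate on the unit circle, which lies in every annulus; it lets null
  sequences be tested coefficient by coefficient.\<close>

lemma circle_coeff_A1_bound:
  assumes "1 < l" "f \<in> A1_circle"
  shows "norm (circle_coeff f k) \<le> qext l f"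
  by (intro norm_circle_coeff_le analytic_circle_continuous A1_circle_analytic norm_le_qext assms)

section \<open>The two maps into the quotient algebra\<close>

context gauge
begin

lemma conv_psi_A1: "conv_psi r H n \<in> A1_circle"
  unfolding conv_psi_def by (rule A1_circle_Laurent_polynomial)

text \<open>With coefficients at most \<open>C * 2 ^ |k|\<close> and radius 2, each term is at most
  \<open>C * 4 ^ |k|\<close>, written as \<open>C * 8 ^ |k| * (1 / 2) ^ |k|\<close>. The cut-off
  turns \<open>8 ^ |k|\<close> into \<open>8 powr (1 / r n)\<close>, and the rest has a sum bounded
  by \<open>s\<close>, independently of \<open>n\<close>.\<close>

lemma conv_psi_Xset:
  assumes H: "H \<in> hyperfun"
  shows "conv_psi r H \<in> Xset r"
proof -
  obtain C where C: "C > 0" "\<And>k. norm (fourier_coeff H k) \<le> C * 2 ^ nat \<bar>k\<bar>"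
    using norm_fourier_coeff_le[OF H, of 2] by auto
  define s :: real where "s = (\<Sum>\<^sub>\<infinity>k::int. (1 / 2) ^ nat \<bar>k\<bar>)"
  have summ: "(\<lambda>k::int. (1 / 2) ^ nat \<bar>k\<bar> :: real) summable_on UNIV"
    by (rule summable_power_nat_abs) auto
  have s: "s \<ge> 0" unfolding s_def by (rule infsum_nonneg) simp
  show ?thesis
  proof (rule XsetI[of _ 2 "(C * s + 1) * 8"])
    show "\<forall>\<^sub>F n in sequentially. qext 2 (conv_psi r H n) \<le> ((C * s + 1) * 8) powr (1 / r n)"
      using eventually_inverse_r_ge[of 1]
    proof eventually_elim
      case (elim n)
      let ?A = "{k. \<bar>real_of_int k\<bar> \<le> 1 / r n}"
      have "norm (holo_ext (conv_psi r H n) z) \<le> C * s * 8 powr (1 / r n)" if z: "z \<in> annulus 2" for z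
      proof -
        have z0: "z \<noteq> 0" using annulus_nonzero[of 2 z] z by auto
        have "holo_ext (conv_psi r H n) z = (\<Sum>k\<in>?A. fourier_coeff H k * z powi k)"
          by (rule holo_ext_unique[OF Laurent_polynomial_holomorphic conv_psi_A1 _ z0])
             (simp add: conv_psi_def)
        also have "norm \<dots> \<le> (\<Sum>k\<in>?A. C * 8 powr (1 / r n) * (1 / 2) ^ nat \<bar>k\<bar>)"
        proof (rule sum_norm_le)
          fix k assume k: "k \<in> ?A"
          have "norm (z powi k) \<le> 2 ^ nat \<bar>k\<bar>"
            using z by (intro norm_powi_le) (auto simp: annulus_def)
          then have "norm (fourier_coeff H k * z powi k) \<le> (C * 2 ^ nat \<bar>k\<bar>) * 2 ^ nat \<bar>k\<bar>"
            unfolding norm_mult using C by (intro mult_mono) auto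
          also have "\<dots> = C * (8 ^ nat \<bar>k\<bar> * (1 / 2) ^ nat \<bar>k\<bar>)"
            by (simp flip: power_mult_distrib)
          also have "\<dots> \<le> C * (8 powr (1 / r n) * (1 / 2) ^ nat \<bar>k\<bar>)"
          proof -
            have "(8::real) ^ nat \<bar>k\<bar> = 8 powr real (nat \<bar>k\<bar>)"
              by (rule powr_realpow [symmetric]) simp
            also have "\<dots> \<le> 8 powr (1 / r n)"
              using k by (intro powr_mono) auto
            finally show ?thesis
              using C(1) by (intro mult_left_mono mult_right_mono) auto
          qed
          finally show "norm (fourier_coeff H k * z powi k) \<le> C * 8 powr (1 / r n) * (1 / 2) ^ nat \<bar>k\<bar>"
            by (simp only: mult.assoc)
        qed
        also have "\<dots> = C * 8 powr (1 / r n) * (\<Sum>k\<in>?A. (1 / 2) ^ nat \<bar>k\<bar>)"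
          by (simp only: sum_distrib_left)
        also have "\<dots> \<le> C * 8 powr (1 / r n) * s"
          unfolding s_def using C(1) summ
          by (intro mult_left_mono finite_sum_le_infsum finite_int_abs_le) auto
        finally show ?thesis by (simp only: mult_ac)
      qed
      then have "qext 2 (conv_psi r H n) \<le> C * s * 8 powr (1 / r n)"
        by (intro qnorm_least) auto
      \<comment> \<open>The constant \<open>C * s\<close> is absorbed into the base; this is where
        \<open>1 \<le> 1 / r n\<close> enters.\<close>
      also have "\<dots> \<le> (C * s + 1) powr (1 / r n) * 8 powr (1 / r n)"
        using elim C(1) s by (intro mult_right_mono constant_le_powr) auto
      also have "\<dots> = ((C * s + 1) * 8) powr (1 / r n)"
        by (rule powr_mult [symmetric])
      finally show ?case .
    qed
    have "C * s + 1 > 0"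
      using C(1) s by (simp add: add_nonneg_pos)
    then show "0 < (C * s + 1) * 8" by simp
  qed (auto simp: conv_psi_A1)
qed

lemma carrier_G_alg: "carrier (G_alg r) = cls r ` Xset r"
  by (auto simp: G_alg_def ring.defs FactRing_def A_RCOSETS_def' cls_def)

lemma linear_ibar: "linear_map complex_ring hyperfun_space (G_alg r) (ibar r)"
  unfolding linear_map_def
proof (intro conjI ballI)
  show "Module.module complex_ring hyperfun_space" by (rule module_hyperfun_space)
  show "Module.module complex_ring (G_alg r)" by (rule algebra.module[OF algebra_G_alg])
  show "ibar r \<in> carrier hyperfun_space \<rightarrow> carrier (G_alg r)"
    by (auto simp: ibar_def carrier_G_alg conv_psi_Xset)
next
  fix H K assume HK: "H \<in> carrier hyperfun_space" "K \<in> carrier hyperfun_space"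
  have "conv_psi r (H \<oplus>\<^bsub>hyperfun_space\<^esub> K) = (\<lambda>n z. conv_psi r H n z + conv_psi r K n z)"
    by (intro ext) (simp add: conv_psi_def on_circle_def fourier_coeff_def
        powi_on_circle_analytic[unfolded on_circle_def] distrib_right sum.distrib)
  then show "ibar r (H \<oplus>\<^bsub>hyperfun_space\<^esub> K) = ibar r H \<oplus>\<^bsub>G_alg r\<^esub> ibar r K"
    using HK ring_hom_add[OF cls_ring_hom, of "conv_psi r H" "conv_psi r K"] conv_psi_Xset
    by (simp add: ibar_def)
next
  fix a H assume H: "H \<in> carrier hyperfun_space"
  have "conv_psi r (a \<odot>\<^bsub>hyperfun_space\<^esub> H) = (\<lambda>n z. a * conv_psi r H n z)"
    by (intro ext) (simp add: conv_psi_def on_circle_def fourier_coeff_def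
        powi_on_circle_analytic[unfolded on_circle_def] sum_distrib_left mult.assoc)
  then show "ibar r (a \<odot>\<^bsub>hyperfun_space\<^esub> H) = a \<odot>\<^bsub>G_alg r\<^esub> ibar r H"
    using H by (simp add: ibar_def smult_cls conv_psi_Xset)
qed

text \<open>For each \<open>k\<close> and each \<open>e < 1\<close> a single large index suffices:
  it keeps the frequency \<open>k\<close>, and the null bound gives
  \<open>e powr (1 / r n) \<le> e\<close>.\<close>

lemma inj_ibar: "inj_on (ibar r) hyperfun"
proof (rule inj_onI)
  fix H K assume HK: "H \<in> hyperfun" "K \<in> hyperfun" and eq: "ibar r H = ibar r K"
  obtain h where h: "h \<in> Nset r" "\<And>n z. conv_psi r H n z = h n z + conv_psi r K n z"
    using cls_eqD[OF eq[unfolded ibar_def] conv_psi_Xset[OF HK(1)]] by metis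
  then obtain l where l: "1 < l" "\<And>n. h n \<in> A1_circle"
    "\<And>e. e > 0 \<Longrightarrow> \<forall>\<^sub>F n in sequentially. qext l (h n) \<le> e powr (1 / r n)"
    unfolding Nset_iff by auto
  have "fourier_coeff H k = fourier_coeff K k" for k
  proof -
    have "norm (fourier_coeff H k - fourier_coeff K k) \<le> e" if e: "0 < e" "e < 1" for e
    proof -
      \<comment> \<open>Three requirements at once: the null bound, the frequency \<open>k\<close>
        inside the cut-off, and an exponent of at least 1.\<close>
      obtain n where n: "qext l (h n) \<le> e powr (1 / r n)" "\<bar>real_of_int k\<bar> \<le> 1 / r n" "1 \<le> 1 / r n"
        using eventually_happens'[OF sequentially_bot eventually_conj[OF l(3)[OF e(1)]
            eventually_conj[OF eventually_inverse_r_ge eventually_inverse_r_ge]]] by blast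
      let ?A = "{k. \<bar>real_of_int k\<bar> \<le> 1 / r n}"
      have coeff: "circle_coeff (conv_psi r L n) k = fourier_coeff L k" for L
        using circle_coeff_polynomial[OF finite_int_abs_le[of "1 / r n"], of "fourier_coeff L" k] n(2)
        by (simp add: conv_psi_def on_circle_def)
      have "circle_coeff (conv_psi r H n) k = circle_coeff (h n) k + circle_coeff (conv_psi r K n) k"
        unfolding ext[of "conv_psi r H n", OF h(2)[of n]]
        by (intro circle_coeff_add analytic_circle_continuous A1_circle_analytic l(2) conv_psi_A1)
      then have "norm (fourier_coeff H k - fourier_coeff K k) = norm (circle_coeff (h n) k)"
        by (simp add: coeff)
      also have "\<dots> \<le> e powr (1 / r n)"
        using circle_coeff_A1_bound[OF l(1,2), of n k] n(1) by linarith
      also have "\<dots> \<le> e powr 1"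
        using e n(3) by (intro powr_mono') auto
      finally show ?thesis using e by simp
    qed
    then have "norm (fourier_coeff H k - fourier_coeff K k) \<le> 0"
      by (intro dense_ge_bounded[of 0 1]) auto
    then show ?thesis by simp
  qed
  then show "H = K"
    using HK by (intro hyperfun_eqI) auto
qed

lemma algebra_morphism_ibar0: "algebra_morphism complex_ring A1_alg (G_alg r) (ibar0 r)"
proof -
  have hom: "ibar0 r \<in> ring_hom A1_alg (G_alg r)"
    using ring_hom_mult[OF cls_ring_hom] ring_hom_add[OF cls_ring_hom] ring_hom_one[OF cls_ring_hom]
      Xset_const
    by (auto simp: ring_hom_def ibar0_def carrier_G_alg)
  then show ?thesis
    unfolding algebra_morphism_def linear_map_def
    using algebra_A1_alg algebra_G_alg algebra.module[OF algebra_A1_alg] algebra.module[OF algebra_G_alg]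
    by (auto simp: ring_hom_def smult_cls Xset_const ibar0_def)
qed

text \<open>The difference \<open>f - g\<close> does not depend on \<open>n\<close>, yet at each
  point it is bounded by a null sequence.\<close>

lemma inj_ibar0: "inj_on (ibar0 r) A1_circle"
proof (rule inj_onI)
  fix f g assume fg: "f \<in> A1_circle" "g \<in> A1_circle" and eq: "ibar0 r f = ibar0 r g"
  obtain h where h: "h \<in> Nset r" "\<And>n z. f z = h n z + g z"
    using cls_eqD[OF eq[unfolded ibar0_def] Xset_const[OF fg(1)]] by metis
  then obtain l where l: "1 < l" "\<And>n. h n \<in> A1_circle"
    "\<And>e. e > 0 \<Longrightarrow> \<forall>\<^sub>F n in sequentially. qext l (h n) \<le> e powr (1 / r n)"
    unfolding Nset_iff by auto
  show "f = g"
  proof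
    fix z
    have "norm (f z - g z) \<le> e" if e: "0 < e" "e < 1" for e
    proof -
      obtain n where n: "qext l (h n) \<le> e powr (1 / r n)" "1 \<le> 1 / r n"
        using eventually_happens'[OF sequentially_bot eventually_conj[OF l(3)[OF e(1)]
            eventually_inverse_r_ge]] by blast
      have "norm (f z - g z) = norm (h n z)"
        using h(2)[of z n] by simp
      also have "\<dots> \<le> e powr (1 / r n)"
        using norm_le_qext[OF l(1,2), of n z] n(1) by linarith
      also have "\<dots> \<le> e powr 1"
        using e n(2) by (intro powr_mono') auto
      finally show ?thesis using e by simp
    qed
    then have "norm (f z - g z) \<le> 0"
      by (intro dense_ge_bounded[of 0 1]) auto
    then show "f z = g z" by simp
  qed
qed

text \<open>On the dropped frequencies \<open>t ^ |k|\<close> is at least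
  \<open>t powr (1 / r n)\<close>. Weighting the coefficients by \<open>(2 * t) ^ |k|\<close>
  therefore gains the factor \<open>t powr - (1 / r n)\<close> on the annulus of radius 2, at the
  cost of a constant \<open>M\<close> depending on \<open>t\<close>.\<close>

lemma ibar_hyperfun_of:
  assumes f: "f \<in> A1_circle"
  shows "ibar r (hyperfun_of f) = ibar0 r f"
  unfolding ibar_def ibar0_def
proof (rule cls_eqI[OF Xset_const[OF f]])
  define h where "h = (\<lambda>n z. conv_psi r (hyperfun_of f) n z + - 1 * f z)"
  have coeff: "fourier_coeff (hyperfun_of f) = circle_coeff f"
    using f by (intro hyperfun_of_analytic A1_circle_analytic)
  show "conv_psi r (hyperfun_of f) n z = h n z + f z" for n z
    by (simp add: h_def)
  have hA: "h n \<in> A1_circle" for n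
    unfolding h_def using f by (intro A1_circle_add conv_psi_A1 A1_circle_cmult)
  show "h \<in> Nset r"
  proof (rule NsetI[OF hA, of 2])
    fix e :: real assume e: "0 < e"
    \<comment> \<open>\<open>2 / t \<le> e\<close> leaves room for absorbing \<open>M\<close> into a
      base 2, and \<open>t \<ge> 1\<close> makes powers of \<open>t\<close> increase with the
      exponent.\<close>
    define t where "t = max 1 (2 / e)"
    have t: "1 \<le> t" "2 \<le> e * t"
      using e by (auto simp: t_def max_def field_simps)
    obtain M where M: "((\<lambda>k. norm (circle_coeff f k) * (2 * t) ^ nat \<bar>k\<bar>) has_sum M) UNIV"
      using A1_circle_coeff_summable[OF f, of "2 * t"] t by (auto simp: summable_on_def)
    have "\<forall>\<^sub>F n in sequentially. M \<le> 2 powr (1 / r n)"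
      \<comment> \<open>The maximum keeps the logarithm meaningful when \<open>M\<close> is 0, as
        happens for \<open>f = 0\<close>.\<close>
      using eventually_inverse_r_ge[of "log 2 (max M 1)"]
    proof eventually_elim
      case (elim n)
      have "M \<le> 2 powr log 2 (max M 1)" by simp
      also have "\<dots> \<le> 2 powr (1 / r n)"
        using elim by (intro powr_mono) auto
      finally show ?case .
    qed
    then show "\<forall>\<^sub>F n in sequentially. qext 2 (h n) \<le> e powr (1 / r n)"
    proof eventually_elim
      case (elim n)
      let ?A = "{k. \<bar>real_of_int k\<bar> \<le> 1 / r n}"
      have "qext 2 (h n) \<le> t powr - (1 / r n) * M"
      proof (rule qnorm_least)
        fix z assume z: "z \<in> annulus 2"
        then have z0: "z \<noteq> 0" using annulus_nonzero[of 2 z] by auto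
        have "holo_ext (h n) z = (\<Sum>k\<in>?A. circle_coeff f k * z powi k) + - 1 * holo_ext f z"
          by (rule holo_ext_unique[OF _ hA _ z0])
             (use holo_ext[OF f] in \<open>auto simp: h_def conv_psi_def coeff on_circle_def fun_eq_iff
                intro!: holomorphic_intros\<close>)
        then have "norm (holo_ext (h n) z) = norm (holo_ext f z - (\<Sum>k\<in>?A. circle_coeff f k * z powi k))"
          by (simp add: norm_minus_commute)
        also have "\<dots> \<le> t powr - (1 / r n)
            * (M - (\<Sum>k\<in>?A. norm (circle_coeff f k) * (2 * t) ^ nat \<bar>k\<bar>))"
        proof (rule norm_infsum_le)
          show "((\<lambda>k. circle_coeff f k * z powi k) has_sum
              (holo_ext f z - (\<Sum>k\<in>?A. circle_coeff f k * z powi k))) (UNIV - ?A)"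
            by (intro has_sum_Diff holo_ext_has_sum f z0 has_sum_finite finite_int_abs_le) simp
          show "((\<lambda>k. t powr - (1 / r n) * (norm (circle_coeff f k) * (2 * t) ^ nat \<bar>k\<bar>)) has_sum
              (t powr - (1 / r n) * (M - (\<Sum>k\<in>?A. norm (circle_coeff f k) * (2 * t) ^ nat \<bar>k\<bar>)))) (UNIV - ?A)"
            by (intro has_sum_cmult_right has_sum_Diff M has_sum_finite finite_int_abs_le) simp
          fix k assume k: "k \<in> UNIV - ?A"
          have "t powr (1 / r n) \<le> t powr real (nat \<bar>k\<bar>)"
            using k t by (intro powr_mono) auto
          also have "\<dots> = t ^ nat \<bar>k\<bar>"
            using t by (intro powr_realpow) auto
          finally have "1 \<le> t powr - (1 / r n) * t ^ nat \<bar>k\<bar>"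
            using t by (simp add: powr_minus field_simps)
          then have *: "2 ^ nat \<bar>k\<bar> * 1 \<le> 2 ^ nat \<bar>k\<bar> * (t powr - (1 / r n) * t ^ nat \<bar>k\<bar>)"
            by (intro mult_left_mono) auto
          have "norm (z powi k) \<le> 2 ^ nat \<bar>k\<bar> * 1"
            using z norm_powi_le[of 2 z k] by (simp add: annulus_def)
          also note *
          also have "2 ^ nat \<bar>k\<bar> * (t powr - (1 / r n) * t ^ nat \<bar>k\<bar>)
              = t powr - (1 / r n) * (2 * t) ^ nat \<bar>k\<bar>"
            by (simp add: power_mult_distrib)
          finally have "norm (z powi k) \<le> t powr - (1 / r n) * (2 * t) ^ nat \<bar>k\<bar>" .
          from mult_left_mono[OF this, of "norm (circle_coeff f k)"]
          show "norm (circle_coeff f k * z powi k)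
              \<le> t powr - (1 / r n) * (norm (circle_coeff f k) * (2 * t) ^ nat \<bar>k\<bar>)"
            by (simp add: norm_mult mult_ac)
        qed
        \<comment> \<open>The subtracted partial sum is nonnegative and may be dropped.\<close>
        also have "\<dots> \<le> t powr - (1 / r n) * M"
          using t by (intro mult_left_mono) (auto intro!: sum_nonneg)
        finally show "norm (holo_ext (h n) z) \<le> t powr - (1 / r n) * M" .
      qed simp
      \<comment> \<open>\<open>M\<close> is eventually below \<open>2 powr (1 / r n)\<close>, and
        \<open>2 \<le> e * t\<close>; afterwards the powers of \<open>t\<close> cancel.\<close>
      also have "\<dots> \<le> t powr - (1 / r n) * (e * t) powr (1 / r n)"
      proof (rule mult_left_mono)
        have "2 powr (1 / r n) \<le> (e * t) powr (1 / r n)"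
          using t r_pos[of n] by (intro powr_mono2) auto
        then show "M \<le> (e * t) powr (1 / r n)"
          using elim by linarith
      qed simp
      also have "\<dots> = e powr (1 / r n)"
        using e t by (simp add: powr_mult powr_minus)
      finally show ?case .
    qed
  qed simp
qed

end

theorem theorem4p5:
  fixes r :: "nat \<Rightarrow> real"
  assumes "\<And>n. r n > 0" and "decseq r" and "r \<longlonglongrightarrow> 0"
  shows "(linear_map complex_ring hyperfun_space (G_alg r) (ibar r) \<and>
          inj_on (ibar r) (carrier hyperfun_space)) \<and>
         (algebra_morphism complex_ring A1_alg (G_alg r) (ibar0 r) \<and>
          inj_on (ibar0 r) (carrier A1_alg)) \<and>
         (\<forall>f\<in>A1_circle. hyperfun_of f \<in> carrier hyperfun_space \<and>
            ibar r (hyperfun_of f) = ibar0 r f)"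
proof -
  interpret gauge r
    using assms by unfold_locales
  show ?thesis
    using linear_ibar inj_ibar algebra_morphism_ibar0 inj_ibar0 ibar_hyperfun_of
      hyperfun_of_analytic(1)[OF A1_circle_analytic]
    by simp
qed

end
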